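(* For each $k\in\{0,1,2\}$, the single-valued SCI problem $P_k^*$ with target $\Xi_k(p,b)=t(b)+\ell\, r_k(p)$ satisfies $$\operatorname{SCI}_{\mathrm G}(P_k^* )=1,\qquad \widehat\Xi_k\equiv_{\mathrm W}\operatorname{Lim}^{(k)},\qquad \operatorname{SCI}^{\lim}_{\mathrm{Comp}}(P_k^* )=k.$$ In particular the three ordinary Weihrauch degrees (for $k=0,1,2$) are $\mathbf 1$, $\operatorname{Lim}$, and $\operatorname{Lim}^{(2)}$.
   Context: Type-2 conventions. $\mathbb N=\{0,1,2,\dots\}$; computable codings of rationals and a computable bijective pairing $\langle\cdot,\cdot\rangle$ on $\mathbb N$ are fixed. Computability on Baire space $\mathbb N^{\mathbb N}$ is Type-2 computability. A representation is a partial surjection $\delta_X:\subseteq\mathbb N^{\mathbb N}\to X$. Real Cauchy representation: $\rho(p)=x$ iff $|r_j-x|\leq2^{-j}$ for all $j$, $r_j$ the rational coded by $p(j)$. A realizer of a represented problem $g$ sends each name of each $u\in\operatorname{dom}(g)$ to a name of an element of $g(u)$. $f\leq_{\mathrm W}g$: there are computable partial functionals $K,H$ such that for every realizer $G$ of $g$, $p\mapsto H(p,G(K(p)))$ realizes $f$; $\equiv_{\mathrm W}$ is mutual reducibility. $\mathbf 1$ is the Weihrauch degree of computable problems having a computable instance. $\operatorname{Lim}(P)(j)=\lim_sP(\langle s,j\rangle)$, with domain those $P$ all of whose columns $s\mapsto P(\langle s,j\rangle)$ are eventually constant; $\operatorname{Lim}^{(0)}=\mathrm{id}_{\mathbb N^{\mathbb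 N}}$, $\operatorname{Lim}^{(k+1)}=\operatorname{Lim}\circ\operatorname{Lim}^{(k)}$. Raw SCI. An SCI problem is $(\Xi,\Omega,(M,d),\Lambda)$ with $\Xi:\Omega\to M$ a map into a metric space and $\Lambda$ a nonempty family of complex-valued functions on $\Omega$ such that agreement on all of $\Lambda$ implies equality of $\Xi$. A general algorithm is a pair $(\Gamma,Q_\Gamma)$, $\Gamma:\Omega\to M$, with finite nonempty $Q_\Gamma(x)\subseteq\Lambda$, such that agreement of $y$ with $x$ on $Q_\Gamma(x)$ implies $\Gamma(y)=\Gamma(x)$ and $Q_\Gamma(y)=Q_\Gamma(x)$ (no computability or continuity required). A height-$m$ raw tower is a family of general algorithms $\Gamma_{n_m,\dots,n_1}$ with all successive pointwise limits existing in $M$ and $\Xi(x)=\lim_{n_m}\cdots\lim_{n_1}\Gamma_{n_m,\dots,n_1}(x)$; height $0$ means $\Xi$ itself is a general algorithm. $\operatorname{SCI}_{\mathrm G}$ is the least height ($\infty$ if none). The problems. $\tau(b)=\sum_{n\geq0}2b(n)3^{-(n+1)}$ for $b\in2^{\mathbb N}$; $\kappa(p)=\tau(0^{p(0)}1\,0^{p(1)}1\,0^{p(2)}1\cdots)$ for $p\in\mathbb N^{\mathbb N}$; $t(b)=\frac14+\frac18\tau(b)$; $\ell=\frac14$. For $k\in\{0,1,2\}$ let $$D_k^*=\{p\in\operatorname{dom}(\rho\circ\operatorname{Lim}^{(k)}):r_k(p):=\rho(\operatorname{Lim}^{(k)}(p))\in[1/3,2/3]\},\qquad \Omega_k^*=D_k^*\times2^{\mathbb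 N}.$$ $P_k^*$ has domain $\Omega_k^*$, target space $[0,1]$ with usual metric and representation $\rho$, target map $\Xi_k(p,b)=t(b)+\ell r_k(p)$, and evaluations $\lambda_*(p,b)=\kappa(p)$, $\lambda_n(p,b)=b(n)$ ($n\in\mathbb N$). The evaluation tables $(\kappa(p),b(0),b(1),\dots)$ determine $(p,b)$ and form a subspace of $\mathbb R^{\mathbb N}$ with the subspace product-Cauchy representation; $\widehat\Xi_k$ is the represented map from this information space to $[0,1]$ sending the table of $(p,b)$ to $\Xi_k(p,b)$. $\operatorname{SCI}^{\lim}_{\mathrm{Comp}}(P_k^* )$ is the least $m\in\mathbb N$ for which there is a computable partial functional $K$ on $\mathbb N^{\mathbb N}$ such that for every input name of every input of $\widehat\Xi_k$, applying $\operatorname{Lim}^{(m)}\circ K$ is defined and gives a $\rho$-name of the value ($\infty$ if none). *)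

theory Defs
  imports
    "HOL-Analysis.Analysis"
    "HOL-Library.Nat_Bijection"
    "HOL-Library.Countable"
    "HOL-Library.Extended_Nat"
begin

type_synonym baire = "nat \<Rightarrow> nat"

text \<open>
  Partial recursive functions relative to an oracle. Programs act on argument lists; a call
  with too few arguments diverges, which is represented by \<^term>\<open>None\<close>.
\<close>

datatype prog =
    Zero
  | Succ
  | Proj nat
  | Query
  | Comp prog "prog list"
  | Prec prog prog
  | Mini prog

primrec run :: "prog \<Rightarrow> baire \<Rightarrow> nat list \<Rightarrow> nat option" where
  "run Zero p xs = Some 0"
| "run Succ p xs = (case xs of [] \<Rightarrow> None | x # _ \<Rightarrow> Some (Suc x))"
| "run (Proj i) p xs = (if i < length xs then Some (xs ! i) else None)"
| "run Query p xs = (case xs of [] \<Rightarrow> None | x # _ \<Rightarrow> Some (p x))"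
| "run (Comp f gs) p xs = Option.bind (those (map (\<lambda>g. run g p xs) gs)) (run f p)"
| "run (Prec f g) p xs =
     (case xs of
        [] \<Rightarrow> None
      | n # ys \<Rightarrow>
          rec_nat (run f p ys) (\<lambda>m r. Option.bind r (\<lambda>y. run g p (m # y # ys))) n)"
| "run (Mini f) p xs =
     (if \<exists>n. run f p (n # xs) = Some 0 \<and> (\<forall>m<n. run f p (m # xs) \<noteq> None)
      then Some (LEAST n. run f p (n # xs) = Some 0)
      else None)"

text \<open>
  A partial functional is computable if some oracle program, run with the argument as oracle,
  computes its values on its domain. Nothing is required outside of the domain, so restrictions
  of computable functionals are computable.
\<close>

definition computable :: "(baire \<rightharpoonup> baire) \<Rightarrow> bool" where
  "computable F \<longleftrightarrow>
     (\<exists>e. \<forall>p q. F p = Some q \<longrightarrow> (\<forall>n. run e p [n] = Some (q n)))"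

definition computable_point :: "baire \<Rightarrow> bool" where
  "computable_point q \<longleftrightarrow> computable (\<lambda>_. Some q)"

definition join :: "baire \<Rightarrow> baire \<Rightarrow> baire" where
  "join p q n = (if even n then p (n div 2) else q (n div 2))"

text \<open>A representation \<open>\<delta>\<close> represents the set \<^term>\<open>ran \<delta>\<close>.\<close>

type_synonym 'a representation = "baire \<rightharpoonup> 'a"

definition subspace_rep :: "'a representation \<Rightarrow> 'a set \<Rightarrow> 'a representation" where
  "subspace_rep \<delta> S = (Some |` S) \<circ>\<^sub>m \<delta>"

definition sequence_rep :: "'a representation \<Rightarrow> (nat \<Rightarrow> 'a) representation" where
  "sequence_rep \<delta> P =
     (if \<forall>n. (\<lambda>j. P (prod_encode (n, j))) \<in> dom \<delta>
      then Some (\<lambda>n. the (\<delta> (\<lambda>j. P (prod_encode (n, j)))))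
      else None)"

text \<open>
  \<^term>\<open>nat_to_rat_surj\<close> is the coding of rationals: it reads a code, via the pairing
  \<^term>\<open>prod_encode\<close>, as numerator and denominator.
\<close>

definition cauchy_name :: "baire \<Rightarrow> real \<Rightarrow> bool" where
  "cauchy_name p x \<longleftrightarrow> (\<forall>j. \<bar>of_rat (nat_to_rat_surj (p j)) - x\<bar> \<le> 1 / 2 ^ j)"

definition rho :: "real representation" where
  "rho p = (if \<exists>x. cauchy_name p x then Some (THE x. cauchy_name p x) else None)"

text \<open>The domain of a multivalued problem is the set of inputs with a nonempty solution set.\<close>

record ('a, 'b) problem =
  in_rep :: "'a representation"
  out_rep :: "'b representation"
  solutions :: "'a \<Rightarrow> 'b set"

definition realizes :: "(baire \<rightharpoonup> baire) \<Rightarrow> ('a, 'b) problem \<Rightarrow> bool" where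
  "realizes G g \<longleftrightarrow>
     (\<forall>p u. in_rep g p = Some u \<and> solutions g u \<noteq> {} \<longrightarrow>
        (\<exists>q y. G p = Some q \<and> out_rep g q = Some y \<and> y \<in> solutions g u))"

definition weihrauch_le :: "('a, 'b) problem \<Rightarrow> ('c, 'd) problem \<Rightarrow> bool"
    (infix "\<le>\<^sub>W" 50) where
  "f \<le>\<^sub>W g \<longleftrightarrow>
     (\<exists>K H. computable K \<and> computable H \<and>
        (\<forall>G. realizes G g \<longrightarrow>
           realizes (\<lambda>p. Option.bind (K p) (\<lambda>q. Option.bind (G q) (\<lambda>r. H (join p r)))) f))"

definition weihrauch_equiv :: "('a, 'b) problem \<Rightarrow> ('c, 'd) problem \<Rightarrow> bool"
    (infix "\<equiv>\<^sub>W" 50) where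
  "f \<equiv>\<^sub>W g \<longleftrightarrow> f \<le>\<^sub>W g \<and> g \<le>\<^sub>W f"

definition baire_problem :: "(baire \<Rightarrow> baire set) \<Rightarrow> (baire, baire) problem" where
  "baire_problem f = \<lparr>in_rep = Some, out_rep = Some, solutions = f\<rparr>"

text \<open>
  A Weihrauch degree is given by the problems on Baire space belonging to it. No degree is lost
  in this way: a represented problem is equivalent to the problem on names that it induces.
\<close>

definition weihrauch_degree :: "('a, 'b) problem \<Rightarrow> (baire \<Rightarrow> baire set) set" where
  "weihrauch_degree g = {f. baire_problem f \<equiv>\<^sub>W g}"

definition computable_problem :: "('a, 'b) problem \<Rightarrow> bool" where
  "computable_problem g \<longleftrightarrow> (\<exists>G. computable G \<and> realizes G g)"

definition has_computable_instance :: "('a, 'b) problem \<Rightarrow> bool" where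
  "has_computable_instance g \<longleftrightarrow>
     (\<exists>p u. computable_point p \<and> in_rep g p = Some u \<and> solutions g u \<noteq> {})"

definition degree_one :: "(baire \<Rightarrow> baire set) set" where
  "degree_one =
     {f. computable_problem (baire_problem f) \<and> has_computable_instance (baire_problem f)}"

definition LimB :: "baire \<rightharpoonup> baire" where
  "LimB P =
     (if \<forall>j. \<exists>v. \<forall>\<^sub>F s in sequentially. P (prod_encode (s, j)) = v
      then Some (\<lambda>j. lim (\<lambda>s. P (prod_encode (s, j))))
      else None)"

primrec LimB_iter :: "nat \<Rightarrow> (baire \<rightharpoonup> baire)" where
  "LimB_iter 0 = Some"
| "LimB_iter (Suc k) = LimB \<circ>\<^sub>m LimB_iter k"

definition Lim_problem :: "nat \<Rightarrow> (baire, baire) problem" where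
  "Lim_problem k = baire_problem (\<lambda>P. set_option (LimB_iter k P))"

definition SCI_lim_Comp :: "('a, 'b) problem \<Rightarrow> enat" where
  "SCI_lim_Comp g = Inf {enat m | m. \<exists>K. computable K \<and> realizes (LimB_iter m \<circ>\<^sub>m K) g}"

record ('x, 'm) sci =
  target :: "'x \<Rightarrow> 'm"
  inputs :: "'x set"
  space_of :: "'m set"
  metric_of :: "'m \<Rightarrow> 'm \<Rightarrow> real"
  evals :: "('x \<Rightarrow> complex) set"

definition sci_problem :: "('x, 'm) sci \<Rightarrow> bool" where
  "sci_problem P \<longleftrightarrow>
     Metric_space (space_of P) (metric_of P) \<and>
     target P \<in> inputs P \<rightarrow> space_of P \<and>
     evals P \<noteq> {} \<and>
     (\<forall>x\<in>inputs P. \<forall>y\<in>inputs P.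
        (\<forall>l\<in>evals P. l x = l y) \<longrightarrow> target P x = target P y)"

definition general_algorithm ::
    "('x, 'm) sci \<Rightarrow> ('x \<Rightarrow> 'm) \<Rightarrow> ('x \<Rightarrow> ('x \<Rightarrow> complex) set) \<Rightarrow> bool" where
  "general_algorithm P \<Gamma> Q \<longleftrightarrow>
     (\<forall>x\<in>inputs P.
        \<Gamma> x \<in> space_of P \<and> finite (Q x) \<and> Q x \<noteq> {} \<and> Q x \<subseteq> evals P \<and>
        (\<forall>y\<in>inputs P. (\<forall>l\<in>Q x. l y = l x) \<longrightarrow> \<Gamma> y = \<Gamma> x \<and> Q y = Q x))"

text \<open>
  \<open>iterated_limit M d m g l\<close>: for \<open>g\<close> indexed by lists \<open>[n\<^sub>m, \<dots>, n\<^sub>1]\<close>, the limits along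
  \<open>n\<^sub>1\<close>, then \<open>n\<^sub>2\<close>, and so on up to \<open>n\<^sub>m\<close> all exist in \<open>(M, d)\<close>, and the last one is \<open>l\<close>.
\<close>

primrec iterated_limit ::
    "'m set \<Rightarrow> ('m \<Rightarrow> 'm \<Rightarrow> real) \<Rightarrow> nat \<Rightarrow> (nat list \<Rightarrow> 'm) \<Rightarrow> 'm \<Rightarrow> bool" where
  "iterated_limit M d 0 g l \<longleftrightarrow> g [] = l"
| "iterated_limit M d (Suc m) g l \<longleftrightarrow>
     (\<exists>h. (\<forall>n. iterated_limit M d m (\<lambda>ns. g (n # ns)) (h n)) \<and>
          limitin (Metric_space.mtopology M d) h l sequentially)"

text \<open>
  For \<open>m = 0\<close> the only index is the empty list, so that the target map itself is required to be
  a general algorithm.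
\<close>

definition raw_tower ::
    "('x, 'm) sci \<Rightarrow> nat \<Rightarrow> (nat list \<Rightarrow> 'x \<Rightarrow> 'm) \<Rightarrow> bool" where
  "raw_tower P m \<Gamma> \<longleftrightarrow>
     (\<forall>ns. length ns = m \<longrightarrow> (\<exists>Q. general_algorithm P (\<Gamma> ns) Q)) \<and>
     (\<forall>x\<in>inputs P.
        iterated_limit (space_of P) (metric_of P) m (\<lambda>ns. \<Gamma> ns x) (target P x))"

definition SCI_G :: "('x, 'm) sci \<Rightarrow> enat" where
  "SCI_G P = Inf {enat m | m. \<exists>\<Gamma>. raw_tower P m \<Gamma>}"

definition tau :: "(nat \<Rightarrow> bool) \<Rightarrow> real" where
  "tau b = (\<Sum>n. 2 * of_bool (b n) / 3 ^ (n + 1))"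

text \<open>
  The bit sequence \<open>0\<^bsup>p(0)\<^esup> 1 0\<^bsup>p(1)\<^esup> 1 \<dots>\<close>. Its first \<open>n + 1\<close> blocks have total length
  greater than \<open>n\<close>, so they determine the bit at position \<open>n\<close>.
\<close>

definition blocks :: "baire \<Rightarrow> nat \<Rightarrow> bool" where
  "blocks p n = concat (map (\<lambda>i. replicate (p i) False @ [True]) [0..<Suc n]) ! n"

definition kappa :: "baire \<Rightarrow> real" where
  "kappa p = tau (blocks p)"

definition t_val :: "(nat \<Rightarrow> bool) \<Rightarrow> real" where
  "t_val b = 1 / 4 + 1 / 8 * tau b"

definition ell :: real where
  "ell = 1 / 4"

definition r_val :: "nat \<Rightarrow> baire \<Rightarrow> real" where
  "r_val k p = the ((rho \<circ>\<^sub>m LimB_iter k) p)"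

definition D_star :: "nat \<Rightarrow> baire set" where
  "D_star k = {p \<in> dom (rho \<circ>\<^sub>m LimB_iter k). r_val k p \<in> {1/3..2/3}}"

definition Omega_star :: "nat \<Rightarrow> (baire \<times> (nat \<Rightarrow> bool)) set" where
  "Omega_star k = D_star k \<times> UNIV"

definition Xi :: "nat \<Rightarrow> baire \<times> (nat \<Rightarrow> bool) \<Rightarrow> real" where
  "Xi k = (\<lambda>(p, b). t_val b + ell * r_val k p)"

definition eval_star :: "baire \<times> (nat \<Rightarrow> bool) \<Rightarrow> complex" where
  "eval_star = (\<lambda>(p, b). complex_of_real (kappa p))"

definition eval_bit :: "nat \<Rightarrow> baire \<times> (nat \<Rightarrow> bool) \<Rightarrow> complex" where
  "eval_bit n = (\<lambda>(p, b). of_bool (b n))"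

definition P_star :: "nat \<Rightarrow> (baire \<times> (nat \<Rightarrow> bool), real) sci" where
  "P_star k =
     \<lparr>target = Xi k, inputs = Omega_star k, space_of = {0..1}, metric_of = dist,
      evals = insert eval_star (range eval_bit)\<rparr>"

definition table :: "baire \<times> (nat \<Rightarrow> bool) \<Rightarrow> nat \<Rightarrow> real" where
  "table = (\<lambda>(p, b) i. case i of 0 \<Rightarrow> kappa p | Suc n \<Rightarrow> of_bool (b n))"

text \<open>
  Since a table determines \<open>(p, b)\<close>, the solution sets are singletons on the information space
  and empty elsewhere.
\<close>

definition Xi_hat :: "nat \<Rightarrow> (nat \<Rightarrow> real, real) problem" where
  "Xi_hat k =
     \<lparr>in_rep = subspace_rep (sequence_rep rho) (table ` Omega_star k),
      out_rep = subspace_rep rho {0..1},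
      solutions = (\<lambda>u. {Xi k w | w. w \<in> Omega_star k \<and> table w = u})\<rparr>"

end

theory Submission imports Defs
begin

text \<open>
  The problem with index \<open>k\<close> asks for \<open>t(b) + r / 4\<close>, where \<open>r\<close> is the real number named by the
  \<open>k\<close>-fold limit of \<open>p\<close>. A name of the table of \<open>(p, b)\<close> gives \<open>p\<close> and \<open>b\<close> themselves: \<open>kappa p\<close> lies in
  the Cantor set, whose gaps allow its ternary digits to be decided one after another from rational
  approximations, and the entries of \<open>p\<close> are the distances between successive ones in the digit
  sequence (lemma \<open>decode_kappa\<close>). After \<open>k\<close> limits, only computable arithmetic remains to be done, so the
  problem is reducible to the \<open>k\<close>-fold limit.

  Conversely, if \<open>q\<close> is the \<open>k\<close>-fold limit of \<open>P\<close>, then some \<open>p\<close> computable from \<open>P\<close> has as its \<open>k\<close>-fold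
  limit a name of \<open>1 / 3 + kappa q / 3\<close>, and the value of the problem at \<open>p\<close> reveals \<open>q\<close>. The key to this,
  and to the solution with \<open>k\<close> limits in which nothing may follow the last limit, is that total
  continuous post-processing of a limit can be moved in front of the limit (lemma \<open>LimB_iter_lift\<close>).

  Fewer limits do not suffice, for topological reasons. Halting programs use finitely much of
  their oracle, so they are continuous. Letting \<open>r\<close> depend on a bit sequence, with \<open>r = 2 / 3\<close> if
  the sequence contains a one and \<open>r = 1 / 3\<close> otherwise, shows that one limit cannot be avoided for
  \<open>k = 1\<close>. For \<open>k = 2\<close>, the condition is that there are infinitely many ones; this is a double limit of
  continuous predicates, but not a simple one (lemma \<open>infinitely_often_not_limit\<close>).

  The raw index does not see any of this. The evaluation \<open>kappa p\<close> discloses all of \<open>p\<close> to an algorithm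
  that is not required to be computable, and the value depends on the remaining evaluations only
  through \<open>t(b)\<close>, which is a limit of functions of finitely many bits of \<open>b\<close> but not itself such a
  function. So exactly one limit is needed, for every \<open>k\<close>.

  The computability proofs use programs as little as possible: composition, search, and a set of
  closure rules for total functionals, which reduce the remaining functionals to the formulas that
  define them. Real arithmetic is done with natural numbers, in fixed-point form.
\<close>

section \<open>Oracle programs\<close>

lemma run_Comp_iff:
  "run (Comp f gs) p xs = Some v \<longleftrightarrow>
     (\<exists>ys. list_all2 (\<lambda>g y. run g p xs = Some y) gs ys \<and> run f p ys = Some v)"
proof -
  have those_iff: "those ms = Some ys \<longleftrightarrow> list_all2 (\<lambda>m y. m = Some y) ms ys" for ms and ys :: "nat list"
  proof (induction ms arbitrary: ys)
    case (Cons m ms)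
    show ?case by (cases m; cases ys) (simp_all flip: Cons.IH, blast)
  qed auto
  show ?thesis
    by (simp add: bind_eq_Some_conv those_iff list_all2_map1)
qed

lemma run_Comp:
  assumes "list_all2 (\<lambda>g y. run g p xs = Some y) gs ys"
  shows "run (Comp f gs) p xs = run f p ys"
proof -
  have "those (map (\<lambda>g. run g p xs) gs) = Some ys"
    using assms by (induction rule: list_all2_induct) auto
  then show ?thesis by simp
qed

lemma run_Mini_iff:
  "run (Mini f) p xs = Some v \<longleftrightarrow>
     run f p (v # xs) = Some 0 \<and> (\<forall>m<v. \<exists>w. run f p (m # xs) = Some (Suc w))"
proof
  assume L: "run (Mini f) p xs = Some v"
  then obtain n where n: "run f p (n # xs) = Some 0" "\<forall>m<n. run f p (m # xs) \<noteq> None"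
    by (auto split: if_splits)
  then have "\<exists>n. run f p (n # xs) = Some 0 \<and> (\<forall>m<n. run f p (m # xs) \<noteq> None)" by blast
  then have v: "v = (LEAST n. run f p (n # xs) = Some 0)" using L by simp
  have 1: "run f p (v # xs) = Some 0" unfolding v using n(1) by (rule LeastI)
  have "v \<le> n" unfolding v using n(1) by (rule Least_le)
  have "\<exists>w. run f p (m # xs) = Some (Suc w)" if "m < v" for m
  proof -
    have "run f p (m # xs) \<noteq> Some 0" using not_less_Least that unfolding v by blast
    moreover have "run f p (m # xs) \<noteq> None" using n(2) that \<open>v \<le> n\<close> by auto
    ultimately show ?thesis by (metis not0_implies_Suc option.exhaust)
  qed
  with 1 show "run f p (v # xs) = Some 0 \<and> (\<forall>m<v. \<exists>w. run f p (m # xs) = Some (Suc w))" by blast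
next
  assume R: "run f p (v # xs) = Some 0 \<and> (\<forall>m<v. \<exists>w. run f p (m # xs) = Some (Suc w))"
  then have "(LEAST n. run f p (n # xs) = Some 0) = v"
    by (intro Least_equality) (auto intro: leI)
  moreover have "\<exists>n. run f p (n # xs) = Some 0 \<and> (\<forall>m<n. run f p (m # xs) \<noteq> None)"
    using R by (metis option.discI)
  ultimately show "run (Mini f) p xs = Some v" by simp
qed

text \<open>
  A halting computation asks its oracle finitely many questions. This continuity is all that the
  lower bounds use about programs.
\<close>

lemma run_finite_use:
  assumes "run e p xs = Some v"
  shows "\<exists>N. \<forall>p'. (\<forall>i<N. p' i = p i) \<longrightarrow> run e p' xs = Some v"
  using assms
proof (induction e arbitrary: xs v)
  case Query
  then show ?case by (force split: list.splits)
next
  case (Comp f gs)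
  from Comp.prems obtain ys where ys: "list_all2 (\<lambda>g y. run g p xs = Some y) gs ys" "run f p ys = Some v"
    unfolding run_Comp_iff by blast
  obtain N where N: "\<And>p'. (\<forall>i<N. p' i = p i) \<Longrightarrow> run f p' ys = Some v"
    using Comp.IH(1)[OF ys(2)] by blast
  have "\<exists>M. \<forall>p'. (\<forall>i<M. p' i = p i) \<longrightarrow> list_all2 (\<lambda>g y. run g p' xs = Some y) gs ys"
    using ys(1) Comp.IH(2)
  proof (induction rule: list_all2_induct)
    case Nil
    then show ?case by simp
  next
    case (Cons g gs y ys)
    have "\<exists>M. \<forall>p'. (\<forall>i<M. p' i = p i) \<longrightarrow> run g p' xs = Some y"
      by (rule Cons.prems) (simp_all add: Cons.hyps)
    moreover have "\<exists>M. \<forall>p'. (\<forall>i<M. p' i = p i) \<longrightarrow> list_all2 (\<lambda>g y. run g p' xs = Some y) gs ys"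
      by (rule Cons.IH, rule Cons.prems) simp_all
    ultimately obtain M1 M2 where
      "\<And>p'. (\<forall>i<M1. p' i = p i) \<Longrightarrow> run g p' xs = Some y"
      "\<And>p'. (\<forall>i<M2. p' i = p i) \<Longrightarrow> list_all2 (\<lambda>g y. run g p' xs = Some y) gs ys"
      by blast
    then show ?case by (intro exI[of _ "max M1 M2"]) auto
  qed
  then obtain M where "\<And>p'. (\<forall>i<M. p' i = p i) \<Longrightarrow> list_all2 (\<lambda>g y. run g p' xs = Some y) gs ys"
    by blast
  with N have "\<forall>p'. (\<forall>i<max N M. p' i = p i) \<longrightarrow> run (Comp f gs) p' xs = Some v"
    unfolding run_Comp_iff by (metis less_max_iff_disj)
  then show ?case by blast
next
  case (Prec f g)
  then obtain n ys where xs: "xs = n # ys" by (auto split: list.splits)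
  define R where "R q = rec_nat (run f q ys) (\<lambda>m r. Option.bind r (\<lambda>y. run g q (m # y # ys)))" for q
  have "R p n = Some v" using Prec.prems by (simp add: xs R_def)
  then have "\<exists>N. \<forall>p'. (\<forall>i<N. p' i = p i) \<longrightarrow> R p' n = Some v"
  proof (induction n arbitrary: v)
    case 0
    then show ?case using Prec.IH(1) by (simp add: R_def)
  next
    case (Suc n)
    from Suc.prems obtain y where y: "R p n = Some y" "run g p (n # y # ys) = Some v"
      by (auto simp: R_def bind_eq_Some_conv)
    from Suc.IH[OF y(1)] obtain N where "\<And>p'. (\<forall>i<N. p' i = p i) \<Longrightarrow> R p' n = Some y" by blast
    moreover from Prec.IH(2)[OF y(2)] obtain M where
      "\<And>p'. (\<forall>i<M. p' i = p i) \<Longrightarrow> run g p' (n # y # ys) = Some v" by blast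
    ultimately have "\<forall>p'. (\<forall>i<max N M. p' i = p i) \<longrightarrow> R p' (Suc n) = Some v"
      by (simp add: R_def)
    then show ?case by blast
  qed
  then show ?case by (simp add: xs R_def)
next
  case (Mini f)
  let ?w = "\<lambda>m. the (run f p (m # xs))"
  have v: "run f p (v # xs) = Some 0" "\<And>m. m < v \<Longrightarrow> \<exists>w. run f p (m # xs) = Some (Suc w)"
    using Mini.prems unfolding run_Mini_iff by auto
  have "\<forall>m\<in>{..v}. \<exists>N. \<forall>p'. (\<forall>i<N. p' i = p i) \<longrightarrow> run f p' (m # xs) = run f p (m # xs)"
  proof
    fix m assume "m \<in> {..v}"
    then have "\<exists>w. run f p (m # xs) = Some w" using v by (metis atMost_iff le_neq_implies_less)
    then obtain w where w: "run f p (m # xs) = Some w" ..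
    show "\<exists>N. \<forall>p'. (\<forall>i<N. p' i = p i) \<longrightarrow> run f p' (m # xs) = run f p (m # xs)"
      using Mini.IH[OF w] w by simp
  qed
  then obtain N where N: "\<And>m p'. m \<le> v \<Longrightarrow> (\<forall>i<N m. p' i = p i) \<Longrightarrow> run f p' (m # xs) = run f p (m # xs)"
    unfolding bchoice_iff by auto
  have "run (Mini f) p' xs = Some v" if "\<forall>i < (\<Sum>m\<le>v. N m). p' i = p i" for p'
  proof -
    have "run f p' (m # xs) = run f p (m # xs)" if "m \<le> v" for m
    proof (rule N[OF that])
      have "N m \<le> (\<Sum>m\<le>v. N m)" using that by (intro member_le_sum) auto
      with \<open>\<forall>i < (\<Sum>m\<le>v. N m). p' i = p i\<close> show "\<forall>i<N m. p' i = p i" by auto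
    qed
    with v show ?thesis unfolding run_Mini_iff by simp
  qed
  then show ?case by blast
qed (auto split: list.splits if_splits)

primrec subst_oracle :: "prog \<Rightarrow> prog \<Rightarrow> prog" where
  "subst_oracle g Zero = Zero"
| "subst_oracle g Succ = Succ"
| "subst_oracle g (Proj i) = Proj i"
| "subst_oracle g Query = Comp g [Proj 0]"
| "subst_oracle g (Comp f fs) = Comp (subst_oracle g f) (map (subst_oracle g) fs)"
| "subst_oracle g (Prec f h) = Prec (subst_oracle g f) (subst_oracle g h)"
| "subst_oracle g (Mini f) = Mini (subst_oracle g f)"

text \<open>
  Oracle questions can be answered by a program that computes the oracle, provided that this
  program is total: an unbounded search in \<open>e\<close> may ask about any argument.
\<close>

lemma run_subst_oracle:
  assumes "\<And>n. run g p [n] = Some (q n)"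
  shows "run (subst_oracle g e) p xs = run e q xs"
proof (induction e arbitrary: xs)
  case Query
  then show ?case by (cases xs) (auto simp: assms)
next
  case (Comp f fs)
  then have "map (\<lambda>h. run h p xs) (map (subst_oracle g) fs) = map (\<lambda>h. run h q xs) fs" by simp
  moreover have "run (subst_oracle g f) p = run f q" using Comp.IH(1) by blast
  ultimately show ?case by (simp del: map_map)
qed (simp_all cong: list.case_cong)

lemma computable_bind:
  assumes "computable F" "computable G"
  shows "computable (\<lambda>p. Option.bind (F p) G)"
proof -
  obtain f where f: "\<And>p q n. F p = Some q \<Longrightarrow> run f p [n] = Some (q n)"
    using assms(1) unfolding computable_def by blast
  obtain g where g: "\<And>p q n. G p = Some q \<Longrightarrow> run g p [n] = Some (q n)"
    using assms(2) unfolding computable_def by blast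
  have "run (subst_oracle f g) p [n] = Some (q n)" if "Option.bind (F p) G = Some q" for p q n
    using that by (auto simp: bind_eq_Some_conv run_subst_oracle[OF f] g)
  then show ?thesis unfolding computable_def by blast
qed

lemma computable_finite_use:
  assumes "computable F" "F p = Some q"
  shows "\<exists>N. \<forall>p' q'. F p' = Some q' \<longrightarrow> (\<forall>i<N. p' i = p i) \<longrightarrow> q' n = q n"
proof -
  obtain e where e: "\<And>p q n. F p = Some q \<Longrightarrow> run e p [n] = Some (q n)"
    using assms(1) unfolding computable_def by blast
  show ?thesis
    using run_finite_use[OF e[OF assms(2)]] e by (metis option.inject)
qed

section \<open>Total recursive functionals\<close>

text \<open>
  The value is an expression in the oracle and in an environment that assigns a number to each
  de Bruijn index below \<open>n\<close>. A functional on the environment, unlike one on lists, turns entering a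
  binder into the shift \<open>\<lambda>i. v (Suc i)\<close>, which disappears by beta reduction. The closure rules
  below can therefore be applied as introduction rules, following the syntax of the expression.
\<close>

definition total_rec :: "nat \<Rightarrow> (baire \<Rightarrow> (nat \<Rightarrow> nat) \<Rightarrow> nat) \<Rightarrow> bool" where
  "total_rec n f \<longleftrightarrow> (\<exists>e. \<forall>p xs. length xs = n \<longrightarrow> run e p xs = Some (f p ((!) xs)))"

abbreviation decidable_rel :: "nat \<Rightarrow> (baire \<Rightarrow> (nat \<Rightarrow> nat) \<Rightarrow> bool) \<Rightarrow> bool" where
  "decidable_rel n P \<equiv> total_rec n (\<lambda>p v. of_bool (P p v))"

named_theorems rec_intros

lemma total_recI:
  assumes "\<And>p xs. length xs = n \<Longrightarrow> run e p xs = Some (f p ((!) xs))"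
  shows "total_rec n f"
  unfolding total_rec_def by (rule exI[of _ e]) (simp add: assms)

lemma total_rec_var [rec_intros]: "i < n \<Longrightarrow> total_rec n (\<lambda>p v. v i)"
  by (rule total_recI[of _ "Proj i"]) simp

lemma total_rec_comp1:
  assumes "total_rec 1 (\<lambda>p v. h p (v 0))" "total_rec n f"
  shows "total_rec n (\<lambda>p v. h p (f p v))"
proof -
  obtain d e where "\<And>p xs. length xs = 1 \<Longrightarrow> run d p xs = Some (h p (xs ! 0))"
    "\<And>p xs. length xs = n \<Longrightarrow> run e p xs = Some (f p ((!) xs))"
    using assms unfolding total_rec_def by auto
  then show ?thesis by (intro total_recI[of _ "Comp d [e]"]) simp
qed

lemma total_rec_Suc [rec_intros]: "total_rec n f \<Longrightarrow> total_rec n (\<lambda>p v. Suc (f p v))"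
  by (rule total_rec_comp1[of "\<lambda>_. Suc"], rule total_recI[of _ Succ])
    (auto simp: length_Suc_conv)

lemma total_rec_query [rec_intros]: "total_rec n f \<Longrightarrow> total_rec n (\<lambda>p v. p (f p v))"
  by (rule total_rec_comp1[of "\<lambda>p x. p x"], rule total_recI[of _ Query])
    (auto simp: length_Suc_conv)

lemma total_rec_const [rec_intros]: "total_rec n (\<lambda>p v. c)"
  by (induction c) (auto intro: total_recI[of _ Zero] total_rec_Suc)

text \<open>
  In the body of the recursion, index 0 is the counter and index 1 is the value reached so far.
\<close>

lemma total_rec_rec_nat [rec_intros]:
  assumes "total_rec n f" "total_rec n k"
    and "total_rec (Suc (Suc n)) (\<lambda>p v. g p (\<lambda>i. v (Suc (Suc i))) (v 0) (v (Suc 0)))"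
  shows "total_rec n (\<lambda>p v. rec_nat (f p v) (g p v) (k p v))"
proof -
  obtain a b c where e:
    "\<And>p xs. length xs = n \<Longrightarrow> run a p xs = Some (f p ((!) xs))"
    "\<And>p xs. length xs = n \<Longrightarrow> run b p xs = Some (k p ((!) xs))"
    "\<And>p xs. length xs = Suc (Suc n) \<Longrightarrow>
      run c p xs = Some (g p (\<lambda>i. xs ! Suc (Suc i)) (xs ! 0) (xs ! Suc 0))"
    using assms unfolding total_rec_def by auto
  have "run (Comp (Prec a c) (b # map Proj [0..<n])) p xs
      = Some (rec_nat (f p ((!) xs)) (g p ((!) xs)) (k p ((!) xs)))"
    if l: "length xs = n" for p xs
  proof -
    have "list_all2 (\<lambda>g y. run g p xs = Some y) (b # map Proj [0..<n]) (k p ((!) xs) # xs)"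
      using e(2)[OF l] l by (simp, simp add: list_all2_conv_all_nth)
    moreover have "rec_nat (run a p xs) (\<lambda>m r. Option.bind r (\<lambda>y. run c p (m # y # xs))) j
      = Some (rec_nat (f p ((!) xs)) (g p ((!) xs)) j)" for j
      by (induction j) (simp_all add: e l)
    ultimately show ?thesis by (simp only: run_Comp) simp
  qed
  then show ?thesis by (rule total_recI)
qed

lemma total_rec_add [rec_intros]:
  assumes "total_rec n f" "total_rec n g"
  shows "total_rec n (\<lambda>p v. f p v + g p v)"
proof -
  have "x + y = rec_nat x (\<lambda>_. Suc) y" for x y :: nat by (induction y) auto
  then show ?thesis by (simp only:) (intro rec_intros assms; simp)
qed


lemma total_rec_comp2:
  assumes "total_rec 2 (\<lambda>p v. h p (v 0) (v (Suc 0)))" "total_rec n f" "total_rec n g"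
  shows "total_rec n (\<lambda>p v. h p (f p v) (g p v))"
proof -
  obtain d a b where "\<And>p xs. length xs = 2 \<Longrightarrow> run d p xs = Some (h p (xs ! 0) (xs ! Suc 0))"
    "\<And>p xs. length xs = n \<Longrightarrow> run a p xs = Some (f p ((!) xs))"
    "\<And>p xs. length xs = n \<Longrightarrow> run b p xs = Some (g p ((!) xs))"
    using assms unfolding total_rec_def by auto
  then show ?thesis by (intro total_recI[of _ "Comp d [a, b]"]) simp
qed

lemma total_rec_mult [rec_intros]:
  assumes "total_rec n f" "total_rec n g"
  shows "total_rec n (\<lambda>p v. f p v * g p v)"
proof (rule total_rec_comp2[OF _ assms])
  have "x * y = rec_nat 0 (\<lambda>_ r. r + x) y" for x y :: nat by (induction y) auto
  then show "total_rec 2 (\<lambda>p v. v 0 * v (Suc 0))" by (simp only:) (intro rec_intros; simp)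
qed

lemma total_rec_power [rec_intros]:
  assumes "total_rec n f" "total_rec n g"
  shows "total_rec n (\<lambda>p v. f p v ^ g p v)"
proof (rule total_rec_comp2[OF _ assms])
  have "x ^ y = rec_nat 1 (\<lambda>_ r. r * x) y" for x y :: nat by (induction y) auto
  then show "total_rec 2 (\<lambda>p v. v 0 ^ v (Suc 0))" by (simp only:) (intro rec_intros; simp)
qed

lemma total_rec_diff [rec_intros]:
  assumes "total_rec n f" "total_rec n g"
  shows "total_rec n (\<lambda>p v. f p v - g p v)"
proof (rule total_rec_comp2[OF _ assms])
  have "rec_nat 0 (\<lambda>m _. m) x = x - 1" for x :: nat by (cases x) auto
  then have "x - y = rec_nat x (\<lambda>_. rec_nat 0 (\<lambda>m _. m)) y" for x y :: nat
    by (induction y) auto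
  then show "total_rec 2 (\<lambda>p v. v 0 - v (Suc 0))" by (simp only:) (intro rec_intros; simp)
qed

lemma decidable_rel_not [rec_intros]:
  assumes "decidable_rel n P"
  shows "decidable_rel n (\<lambda>p v. \<not> P p v)"
proof -
  have "of_bool (\<not> b) = (1 - of_bool b :: nat)" for b by simp
  then show ?thesis by (simp only:) (intro rec_intros assms)
qed

lemma decidable_rel_conj [rec_intros]:
  assumes "decidable_rel n P" "decidable_rel n Q"
  shows "decidable_rel n (\<lambda>p v. P p v \<and> Q p v)"
  unfolding of_bool_conj by (intro rec_intros assms)

lemma decidable_rel_le [rec_intros]:
  assumes "total_rec n f" "total_rec n g"
  shows "decidable_rel n (\<lambda>p v. f p v \<le> g p v)"
proof -
  have "of_bool (x \<le> y) = 1 - (x - y)" for x y :: nat by simp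
  then show ?thesis by (simp only:) (intro rec_intros assms)
qed

lemma decidable_rel_eq [rec_intros]:
  assumes "total_rec n f" "total_rec n g"
  shows "decidable_rel n (\<lambda>p v. f p v = g p v)"
  unfolding eq_iff by (intro rec_intros assms)

lemma total_rec_if [rec_intros]:
  assumes "decidable_rel n P" "total_rec n f" "total_rec n g"
  shows "total_rec n (\<lambda>p v. if P p v then f p v else g p v)"
proof -
  have "(if b then x else y) = of_bool b * x + of_bool (\<not> b) * y" for b and x y :: nat by simp
  then show ?thesis by (simp only:) (intro rec_intros assms)
qed

text \<open>
  Iterated operations such as bounded sums are recursions whose summand does not mention the
  accumulated value, so the variable for it has to be skipped.
\<close>

lemma total_rec_insert_var:
  assumes "total_rec (Suc n) (\<lambda>p v. g p (\<lambda>i. v (Suc i)) (v 0))"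
  shows "total_rec (Suc (Suc n)) (\<lambda>p v. g p (\<lambda>i. v (Suc (Suc i))) (v 0))"
proof -
  obtain e where e: "\<And>p xs. length xs = Suc n \<Longrightarrow> run e p xs = Some (g p (\<lambda>i. xs ! Suc i) (xs ! 0))"
    using assms unfolding total_rec_def by auto
  have "run (Comp e (Proj 0 # map Proj [2..<Suc (Suc n)])) p xs
      = Some (g p (\<lambda>i. xs ! Suc (Suc i)) (xs ! 0))" if l: "length xs = Suc (Suc n)" for p xs
  proof -
    obtain x y zs where xs: "xs = x # y # zs" "length zs = n"
      using l by (metis length_Suc_conv)
    have "list_all2 (\<lambda>g y. run g p xs = Some y) (Proj 0 # map Proj [2..<Suc (Suc n)]) (x # zs)"
      using xs by (auto simp: list_all2_conv_all_nth nth_Cons split: nat.split simp del: upt_Suc)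
    from run_Comp[OF this] show ?thesis using xs by (simp add: e)
  qed
  then show ?thesis by (rule total_recI)
qed

lemma total_rec_sum [rec_intros]:
  assumes "total_rec (Suc n) (\<lambda>p v. g p (\<lambda>i. v (Suc i)) (v 0))" "total_rec n k"
  shows "total_rec n (\<lambda>p v. \<Sum>m<k p v. g p v m)"
proof -
  have "(\<Sum>m<k. g m) = rec_nat 0 (\<lambda>m y. g m + y) k" for k and g :: "nat \<Rightarrow> nat"
    by (induction k) auto
  then show ?thesis
    by (simp only:) (intro rec_intros assms total_rec_insert_var; simp)
qed

lemma decidable_rel_Bex [rec_intros]:
  assumes "decidable_rel (Suc n) (\<lambda>p v. P p (\<lambda>i. v (Suc i)) (v 0))" "total_rec n k"
  shows "decidable_rel n (\<lambda>p v. \<exists>m<k p v. P p v m)"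
proof -
  have "(\<exists>m<k. P m) \<longleftrightarrow> \<not> (\<Sum>m<k. of_bool (P m) :: nat) = 0" for k and P :: "nat \<Rightarrow> bool"
    by (auto simp del: sum_of_bool_eq)
  then show ?thesis by (simp only:) (intro rec_intros assms)
qed

lemma total_rec_div [rec_intros]:
  assumes "total_rec n f" "total_rec n g"
  shows "total_rec n (\<lambda>p v. f p v div g p v)"
proof (rule total_rec_comp2[OF _ assms])
  have "x div y = (if y = 0 then 0 else \<Sum>m<x. of_bool ((m + 1) * y \<le> x))" for x y :: nat
  proof (cases "y = 0")
    case False
    then have "(m + 1) * y \<le> x \<longleftrightarrow> m < x div y" for m
      by (simp add: less_eq_div_iff_mult_less_eq Suc_le_eq[symmetric])
    then have "{..<x} \<inter> {m. (m + 1) * y \<le> x} = {..<x div y}"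
      using div_le_dividend[of x y] by (auto intro: less_le_trans)
    with False show ?thesis by (simp only: sum_of_bool_eq) simp
  qed simp
  then show "total_rec 2 (\<lambda>p v. v 0 div v (Suc 0))"
    by (simp only:) (intro rec_intros; simp)
qed

lemma decidable_rel_even [rec_intros]:
  assumes "total_rec n f"
  shows "decidable_rel n (\<lambda>p v. even (f p v))"
proof -
  have "even x \<longleftrightarrow> x div 2 * 2 = x" for x :: nat by presburger
  then show ?thesis by (simp only:) (intro rec_intros assms)
qed

lemma total_rec_prod_encode [rec_intros]:
  assumes "total_rec n f" "total_rec n g"
  shows "total_rec n (\<lambda>p v. prod_encode (f p v, g p v))"
  unfolding prod_encode_def prod.case triangle_def by (intro rec_intros assms)

lemma
  shows fst_prod_decode_le: "fst (prod_decode x) \<le> x"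
    and snd_prod_decode_le: "snd (prod_decode x) \<le> x"
  using le_prod_encode_1[of "fst (prod_decode x)" "snd (prod_decode x)"]
    le_prod_encode_2[of "snd (prod_decode x)" "fst (prod_decode x)"] by simp_all

text \<open>
  The components of a pair are bounded by its code, so they are found by a bounded search, which is
  written as a sum with one nonzero term.
\<close>

lemma total_rec_fst_decode [rec_intros]:
  assumes "total_rec n f"
  shows "total_rec n (\<lambda>p v. fst (prod_decode (f p v)))"
proof (rule total_rec_comp1[OF _ assms])
  have "fst (prod_decode x)
      = (\<Sum>a<Suc x. if \<exists>b<Suc x. prod_encode (a, b) = x then a else 0)" for x
  proof -
    have "(\<exists>b<Suc x. prod_encode (a, b) = x) \<longleftrightarrow> a = fst (prod_decode x)" for a
      using snd_prod_decode_le[of x]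
      by (metis fst_conv le_imp_less_Suc prod.collapse prod_decode_inverse prod_encode_inverse)
    then show ?thesis using fst_prod_decode_le[of x] by (simp add: sum.delta)
  qed
  then show "total_rec 1 (\<lambda>p v. fst (prod_decode (v 0)))"
    by (simp only:) (intro rec_intros; simp)
qed

lemma total_rec_snd_decode [rec_intros]:
  assumes "total_rec n f"
  shows "total_rec n (\<lambda>p v. snd (prod_decode (f p v)))"
proof (rule total_rec_comp1[OF _ assms])
  have "snd (prod_decode x)
      = (\<Sum>b<Suc x. if prod_encode (fst (prod_decode x), b) = x then b else 0)" for x
  proof -
    have "prod_encode (fst (prod_decode x), b) = x \<longleftrightarrow> b = snd (prod_decode x)" for b
      by (metis prod.collapse prod_decode_inverse prod_encode_inverse snd_conv)
    then show ?thesis using snd_prod_decode_le[of x] by (simp add: sum.delta)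
  qed
  then show "total_rec 1 (\<lambda>p v. snd (prod_decode (v 0)))"
    by (simp only:) (intro rec_intros; simp)
qed

section \<open>Partial computable functionals\<close>

lemma computable_total:
  assumes "total_rec 1 (\<lambda>p v. F p (v 0))"
  shows "computable (\<lambda>p. Some (F p))"
proof -
  obtain e where "\<And>p xs. length xs = 1 \<Longrightarrow> run e p xs = Some (F p (xs ! 0))"
    using assms unfolding total_rec_def by auto
  then have "run e p [n] = Some (F p n)" for p n by simp
  then show ?thesis unfolding computable_def by auto
qed

lemma computable_restrict:
  assumes "computable F" "\<And>p q. G p = Some q \<Longrightarrow> F p = Some q"
  shows "computable G"
  using assms unfolding computable_def by metis

lemma computable_join:
  assumes "computable F" "computable G"
  shows "computable (\<lambda>p. Option.bind (F p) (\<lambda>a. Option.bind (G p) (\<lambda>b. Some (join a b))))"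
proof -
  obtain f where f: "\<And>p q n. F p = Some q \<Longrightarrow> run f p [n] = Some (q n)"
    using assms(1) unfolding computable_def by blast
  obtain g where g: "\<And>p q n. G p = Some q \<Longrightarrow> run g p [n] = Some (q n)"
    using assms(2) unfolding computable_def by blast
  have "total_rec 1 (\<lambda>p v. v 0 div 2)"
    "total_rec 3 (\<lambda>p v. if even (v 0) then v 1 else v 2)"
    by (intro rec_intros; simp)+
  then obtain h c where *: "\<And>p xs. length xs = 1 \<Longrightarrow> run h p xs = Some (xs ! 0 div 2)"
    "\<And>p xs. length xs = 3 \<Longrightarrow> run c p xs = Some (if even (xs ! 0) then xs ! 1 else xs ! 2)"
    unfolding total_rec_def by auto
  have h: "run h p [n] = Some (n div 2)"
    and c: "run c p [n, a, b] = Some (if even n then a else b)" for p n a b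
    using *(1)[of "[n]" p] *(2)[of "[n, a, b]" p] by simp_all
  have "run (Comp c [Proj 0, Comp f [h], Comp g [h]]) p [n] = Some (join a b n)"
    if "F p = Some a" "G p = Some b" for p a b n
    using that by (simp add: f g h c join_def)
  then show ?thesis
    unfolding computable_def bind_eq_Some_conv by (metis option.inject)
qed

text \<open>
  Unbounded search is the one source of partiality: the functionals below are total or composed of
  total ones and this one.
\<close>

definition search :: "baire \<rightharpoonup> baire" where
  "search q = (if \<forall>i. \<exists>n. q n = i then Some (\<lambda>i. LEAST n. q n = i) else None)"

lemma computable_search: "computable search"
proof -
  have "decidable_rel 2 (\<lambda>q v. \<not> q (v 0) = v 1)" by (intro rec_intros; simp)
  then obtain e where "\<And>q xs. length xs = 2 \<Longrightarrow> run e q xs = Some (of_bool (q (xs ! 0) \<noteq> xs ! 1))"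
    unfolding total_rec_def by auto
  from this[of "[_, _]"] have e: "run e q [n, i] = Some (of_bool (q n \<noteq> i))" for q n i by simp
  have "run (Mini e) q [i] = Some (LEAST n. q n = i)" if "\<exists>n. q n = i" for q i
  proof -
    have "q (LEAST n. q n = i) = i" using that by (rule LeastI_ex)
    moreover have "\<exists>w. run e q [m, i] = Some (Suc w)" if "m < (LEAST n. q n = i)" for m
      using not_less_Least[OF that] by (simp add: e)
    ultimately show ?thesis by (simp add: run_Mini_iff e del: run.simps)
  qed
  then show ?thesis by (auto simp: computable_def search_def split: if_splits simp del: run.simps intro!: exI[of _ "Mini e"])
qed

section \<open>The Weihrauch preorder\<close>

lemma computable_id: "computable Some"
  using computable_total[of "\<lambda>p. p"] by (simp add: rec_intros)

lemma computable_even_part: "computable (\<lambda>w. Some (\<lambda>n. w (2 * n)))"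
  by (rule computable_total) (intro rec_intros; simp)

lemma computable_odd_part: "computable (\<lambda>w. Some (\<lambda>n. w (2 * n + 1)))"
  by (rule computable_total) (intro rec_intros; simp)

lemma join_parts [simp]:
  "join p q (2 * n) = p n" "join p q (Suc (2 * n)) = q n"
  by (auto simp: join_def)

lemma weihrauch_leI:
  assumes "computable K" "computable H"
    and "\<And>G p u. realizes G g \<Longrightarrow> in_rep f p = Some u \<Longrightarrow> solutions f u \<noteq> {} \<Longrightarrow>
      \<exists>q r s y. K p = Some q \<and> G q = Some r \<and> H (join p r) = Some s
        \<and> out_rep f s = Some y \<and> y \<in> solutions f u"
  shows "f \<le>\<^sub>W g"
  unfolding weihrauch_le_def
proof (intro exI conjI allI impI)
  show "computable K" "computable H" by fact+
  fix G assume G: "realizes G g"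
  show "realizes (\<lambda>p. Option.bind (K p) (\<lambda>q. Option.bind (G q) (\<lambda>r. H (join p r)))) f"
    unfolding realizes_def
  proof (intro allI impI, elim conjE)
    fix p u assume "in_rep f p = Some u" "solutions f u \<noteq> {}"
    from assms(3)[OF G this] show "\<exists>s y. Option.bind (K p) (\<lambda>q. Option.bind (G q) (\<lambda>r. H (join p r))) = Some s
        \<and> out_rep f s = Some y \<and> y \<in> solutions f u"
      by (elim exE conjE) (simp only: Option.bind.simps, blast)
  qed
qed

lemma realizesD:
  assumes "realizes G g" "in_rep g p = Some u" "solutions g u \<noteq> {}"
  obtains q y where "G p = Some q" "out_rep g q = Some y" "y \<in> solutions g u"
  using assms unfolding realizes_def by blast

lemma weihrauch_le_trans:
  assumes "f \<le>\<^sub>W g" "g \<le>\<^sub>W h"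
  shows "f \<le>\<^sub>W h"
proof -
  obtain K1 H1 where 1: "computable K1" "computable H1"
    "\<And>G. realizes G g \<Longrightarrow> realizes (\<lambda>p. Option.bind (K1 p) (\<lambda>q. Option.bind (G q) (\<lambda>r. H1 (join p r)))) f"
    using assms(1) unfolding weihrauch_le_def by blast
  obtain K2 H2 where 2: "computable K2" "computable H2"
    "\<And>G. realizes G h \<Longrightarrow> realizes (\<lambda>p. Option.bind (K2 p) (\<lambda>q. Option.bind (G q) (\<lambda>r. H2 (join p r)))) g"
    using assms(2) unfolding weihrauch_le_def by blast
  define H where "H = (\<lambda>w. let p = \<lambda>n. w (2 * n); r = \<lambda>n. w (2 * n + 1) in
    Option.bind (K1 p) (\<lambda>q. Option.bind (H2 (join q r)) (\<lambda>r'. H1 (join p r'))))"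
  have "computable H"
  proof -
    note p = computable_even_part
    note r = computable_odd_part
    note q = computable_bind[OF p 1(1)]
    note r' = computable_bind[OF computable_join[OF q r] 2(2)]
    note s = computable_bind[OF computable_join[OF p r'] 1(2)]
    show ?thesis by (rule computable_restrict[OF s]) (auto simp: H_def Let_def bind_eq_Some_conv)
  qed
  moreover have "computable (\<lambda>p. Option.bind (K1 p) K2)" by (rule computable_bind) fact+
  moreover have "realizes (\<lambda>p. Option.bind (Option.bind (K1 p) K2) (\<lambda>q. Option.bind (G q) (\<lambda>r. H (join p r)))) f"
    if "realizes G h" for G
  proof -
    have "(\<lambda>p. Option.bind (K1 p) (\<lambda>q. Option.bind (Option.bind (K2 q) (\<lambda>q'. Option.bind (G q') (\<lambda>r. H2 (join q r))))
          (\<lambda>r'. H1 (join p r'))))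
      = (\<lambda>p. Option.bind (Option.bind (K1 p) K2) (\<lambda>q. Option.bind (G q) (\<lambda>r. H (join p r))))"
    proof
      fix p
      show "Option.bind (K1 p) (\<lambda>q. Option.bind (Option.bind (K2 q) (\<lambda>q'. Option.bind (G q') (\<lambda>r. H2 (join q r))))
          (\<lambda>r'. H1 (join p r')))
        = Option.bind (Option.bind (K1 p) K2) (\<lambda>q. Option.bind (G q) (\<lambda>r. H (join p r)))"
        by (cases "K1 p") (simp_all add: H_def)
    qed
    with 1(3)[OF 2(3)[OF that]] show ?thesis by simp
  qed
  ultimately show ?thesis unfolding weihrauch_le_def by blast
qed

lemma weihrauch_degree_eq:
  assumes "f \<equiv>\<^sub>W g"
  shows "weihrauch_degree f = weihrauch_degree g"
proof (intro set_eqI iffI)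
  fix h assume "h \<in> weihrauch_degree f"
  with assms show "h \<in> weihrauch_degree g"
    unfolding weihrauch_degree_def weihrauch_equiv_def mem_Collect_eq
    by (meson weihrauch_le_trans)
next
  fix h assume "h \<in> weihrauch_degree g"
  with assms show "h \<in> weihrauch_degree f"
    unfolding weihrauch_degree_def weihrauch_equiv_def mem_Collect_eq
    by (meson weihrauch_le_trans)
qed

lemma computable_problem_le:
  assumes "f \<le>\<^sub>W g" "computable_problem g"
  shows "computable_problem f"
proof -
  obtain K H where KH: "computable K" "computable H"
    "\<And>G. realizes G g \<Longrightarrow> realizes (\<lambda>p. Option.bind (K p) (\<lambda>q. Option.bind (G q) (\<lambda>r. H (join p r)))) f"
    using assms(1) unfolding weihrauch_le_def by blast
  obtain G where G: "computable G" "realizes G g"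
    using assms(2) unfolding computable_problem_def by blast
  note c = computable_bind[OF computable_join[OF computable_id computable_bind[OF KH(1) G(1)]] KH(2)]
  have "computable (\<lambda>p. Option.bind (K p) (\<lambda>q. Option.bind (G q) (\<lambda>r. H (join p r))))"
    by (rule computable_restrict[OF c]) (auto simp: bind_eq_Some_conv)
  with KH(3)[OF G(2)] show ?thesis unfolding computable_problem_def by blast
qed

text \<open>
  A reduction has to work with a realizer of \<open>f\<close> that is undefined outside of the domain, so it
  sends instances to instances; being computable, it sends computable ones to computable ones.
\<close>

lemma has_computable_instance_le:
  assumes "g \<le>\<^sub>W baire_problem f" "has_computable_instance g"
  shows "has_computable_instance (baire_problem f)"
proof -
  obtain K H where KH: "computable K" "computable H"
    "\<And>G. realizes G (baire_problem f) \<Longrightarrow>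
      realizes (\<lambda>p. Option.bind (K p) (\<lambda>q. Option.bind (G q) (\<lambda>r. H (join p r)))) g"
    using assms(1) unfolding weihrauch_le_def by blast
  obtain p u where p: "computable_point p" "in_rep g p = Some u" "solutions g u \<noteq> {}"
    using assms(2) unfolding has_computable_instance_def by blast
  define G where "G p = (if f p = {} then None else Some (SOME q. q \<in> f p))" for p
  have "realizes G (baire_problem f)"
    by (auto simp: realizes_def G_def baire_problem_def some_in_eq)
  from realizesD[OF KH(3)[OF this] p(2,3)] obtain q where q: "K p = Some q" "f q \<noteq> {}"
    by (fastforce simp: bind_eq_Some_conv G_def split: if_splits)
  have "computable (\<lambda>w. Option.bind (Some p) K)"
    using p(1) KH(1) unfolding computable_point_def by (rule computable_bind)
  with q have "computable_point q" by (simp add: computable_point_def)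
  with q show ?thesis by (auto simp: has_computable_instance_def baire_problem_def)
qed

text \<open>
  The reduction puts a fixed computable question to \<open>g\<close>, only because it must ask one, and ignores
  the answer.
\<close>

lemma weihrauch_le_of_computable:
  assumes "computable_problem f" "has_computable_instance g"
  shows "f \<le>\<^sub>W g"
proof -
  obtain F where F: "computable F" "realizes F f"
    using assms(1) unfolding computable_problem_def by blast
  obtain q v where q: "computable_point q" "in_rep g q = Some v" "solutions g v \<noteq> {}"
    using assms(2) unfolding has_computable_instance_def by blast
  show ?thesis
  proof (rule weihrauch_leI)
    show "computable (\<lambda>_. Some q)" using q(1) by (simp add: computable_point_def)
    show "computable (\<lambda>w. Option.bind (Some (\<lambda>n. w (2 * n))) F)"
      using computable_even_part F(1) by (rule computable_bind)
    fix G p u assume "realizes G g" and p: "in_rep f p = Some u" "solutions f u \<noteq> {}"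
    from realizesD[OF this(1) q(2,3)] obtain r where "G q = Some r" by blast
    moreover from realizesD[OF F(2) p] obtain s y where
      "F p = Some s" "out_rep f s = Some y" "y \<in> solutions f u" by blast
    ultimately show "\<exists>q' r s y. Some q = Some q' \<and> G q' = Some r
      \<and> Option.bind (Some (\<lambda>n. join p r (2 * n))) F = Some s \<and> out_rep f s = Some y \<and> y \<in> solutions f u"
      by simp
  qed
qed

lemma weihrauch_degree_eq_one:
  assumes "computable_problem g" "has_computable_instance g"
  shows "weihrauch_degree g = degree_one"
proof (intro set_eqI iffI)
  fix f assume "f \<in> weihrauch_degree g"
  then have "baire_problem f \<le>\<^sub>W g" "g \<le>\<^sub>W baire_problem f"
    by (simp_all add: weihrauch_degree_def weihrauch_equiv_def)
  with assms show "f \<in> degree_one"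
    by (simp add: degree_one_def computable_problem_le has_computable_instance_le)
next
  fix f assume "f \<in> degree_one"
  with assms show "f \<in> weihrauch_degree g"
    by (simp add: degree_one_def weihrauch_degree_def weihrauch_equiv_def weihrauch_le_of_computable)
qed

section \<open>Limits\<close>

lemma LimB_eq_Some_iff:
  "LimB P = Some q \<longleftrightarrow> (\<forall>j. \<forall>\<^sub>F s in sequentially. P (prod_encode (s, j)) = q j)"
proof -
  have *: "lim (\<lambda>s. P (prod_encode (s, j))) = v"
    if "\<forall>\<^sub>F s in sequentially. P (prod_encode (s, j)) = v" for j v
    by (rule limI, rule tendsto_eventually) fact
  show ?thesis
  proof
    assume L: "LimB P = Some q"
    show "\<forall>j. \<forall>\<^sub>F s in sequentially. P (prod_encode (s, j)) = q j"
    proof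
      fix j
      from L obtain v where v: "\<forall>\<^sub>F s in sequentially. P (prod_encode (s, j)) = v"
        by (auto simp: LimB_def split: if_splits)
      moreover from L have "q j = lim (\<lambda>s. P (prod_encode (s, j)))"
        by (auto simp: LimB_def split: if_splits)
      ultimately show "\<forall>\<^sub>F s in sequentially. P (prod_encode (s, j)) = q j" using *[OF v] by simp
    qed
  next
    assume "\<forall>j. \<forall>\<^sub>F s in sequentially. P (prod_encode (s, j)) = q j"
    then show "LimB P = Some q" using * by (auto simp: LimB_def)
  qed
qed

text \<open>
  Continuity of \<open>f\<close> for discrete values; the argument may be an element of Baire space or of Cantor
  space.
\<close>

definition finite_use :: "((nat \<Rightarrow> 'a) \<Rightarrow> 'b) \<Rightarrow> bool" where
  "finite_use f \<longleftrightarrow> (\<forall>q. \<exists>N. \<forall>q'. (\<forall>m<N. q' m = q m) \<longrightarrow> f q' = f q)"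

lemma finite_useI:
  assumes "\<And>q q'. (\<And>m. m < N \<Longrightarrow> q' m = q m) \<Longrightarrow> f q' = f q"
  shows "finite_use f"
  unfolding finite_use_def using assms by blast

lemma finite_use_comp:
  assumes "finite_use f" "\<And>i. finite_use (\<lambda>x. g x i)"
  shows "finite_use (\<lambda>x. f (g x))"
  unfolding finite_use_def
proof
  fix x
  obtain N where N: "\<And>q. \<forall>m<N. q m = g x m \<Longrightarrow> f q = f (g x)"
    using assms(1) unfolding finite_use_def by metis
  have "\<forall>i. \<exists>M. \<forall>x'. (\<forall>m<M. x' m = x m) \<longrightarrow> g x' i = g x i"
    using assms(2) unfolding finite_use_def by blast
  then obtain M where M: "\<And>i x'. \<forall>m<M i. x' m = x m \<Longrightarrow> g x' i = g x i"
    unfolding choice_iff by auto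
  have "f (g x') = f (g x)" if "\<forall>m < (\<Sum>i<N. M i). x' m = x m" for x'
  proof (rule N, intro allI impI)
    fix i assume "i < N"
    then have "M i \<le> (\<Sum>i<N. M i)" by (intro member_le_sum) auto
    with that show "g x' i = g x i" by (intro M) auto
  qed
  then show "\<exists>N. \<forall>x'. (\<forall>m<N. x' m = x m) \<longrightarrow> f (g x') = f (g x)" by blast
qed

text \<open>
  A position in the input of a \<open>k\<close>-fold limit is a nested pair
  \<open>\<langle>s\<^sub>1, \<langle>s\<^sub>2, \<dots> \<langle>s\<^sub>k, j\<rangle> \<dots>\<rangle>\<rangle>\<close>. The first function extracts \<open>j\<close>, the second one replaces \<open>j\<close>
  by another index and keeps the \<open>s\<^sub>i\<close>.
\<close>

primrec innermost :: "nat \<Rightarrow> nat \<Rightarrow> nat" where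
  "innermost 0 i = i"
| "innermost (Suc k) i = snd (prod_decode (innermost k i))"

primrec set_innermost :: "nat \<Rightarrow> nat \<Rightarrow> nat \<Rightarrow> nat" where
  "set_innermost 0 i m = m"
| "set_innermost (Suc k) i m = set_innermost k i (prod_encode (fst (prod_decode (innermost k i)), m))"

lemma set_innermost_innermost [simp]: "set_innermost k i (innermost k i) = i"
  by (induction k) auto

text \<open>
  A total continuous functional can be pulled inside a limit: it reads only finitely many entries of
  the limit, and from some stage on the approximations agree with the limit on all of them. Repeating
  this \<open>k\<close> times turns post-processing of a \<open>k\<close>-fold limit into pre-processing of its input.
\<close>

lemma LimB_iter_lift:
  assumes "LimB_iter k P = Some q" "\<And>j. finite_use (\<lambda>q. F q j)"
  shows "LimB_iter k (\<lambda>i. F (\<lambda>m. P (set_innermost k i m)) (innermost k i)) = Some (F q)"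
  using assms
proof (induction k arbitrary: q F)
  case (Suc k)
  from Suc.prems(1) obtain Q where Q: "LimB_iter k P = Some Q" "LimB Q = Some q"
    by (auto simp: map_comp_Some_iff)
  \<comment> \<open>the last limit is undone: \<open>F\<close> is applied to each of its stages separately\<close>
  define F' where "F' Q i = F (\<lambda>m. Q (prod_encode (fst (prod_decode i), m))) (snd (prod_decode i))" for Q i
  have "finite_use (\<lambda>Q. F' Q i)" for i
    unfolding F'_def
    by (rule finite_use_comp[OF Suc.prems(2)], rule finite_useI) auto
  from Suc.IH[OF Q(1), of F', OF this]
  have "LimB_iter k (\<lambda>i. F (\<lambda>m. P (set_innermost (Suc k) i m)) (innermost (Suc k) i)) = Some (F' Q)"
    by (simp add: F'_def[abs_def])
  moreover have "LimB (F' Q) = Some (F q)"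
    unfolding LimB_eq_Some_iff
  proof
    fix j
    obtain N where N: "\<And>q'. \<forall>m<N. q' m = q m \<Longrightarrow> F q' j = F q j"
      using Suc.prems(2)[of j] unfolding finite_use_def by metis
    have "\<forall>\<^sub>F s in sequentially. \<forall>m\<in>{..<N}. Q (prod_encode (s, m)) = q m"
      using Q(2) unfolding LimB_eq_Some_iff by (intro eventually_ball_finite) auto
    then show "\<forall>\<^sub>F s in sequentially. F' Q (prod_encode (s, j)) = F q j"
      by (rule eventually_mono) (simp add: F'_def, rule N, simp)
  qed
  ultimately show ?case by (simp add: map_comp_Some_iff)
qed simp

lemma total_rec_innermost [rec_intros]:
  "total_rec n f \<Longrightarrow> total_rec n (\<lambda>p v. innermost k (f p v))"
  by (induction k) (simp_all add: total_rec_snd_decode)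

lemma total_rec_set_innermost [rec_intros]:
  assumes "total_rec n f" "total_rec n g"
  shows "total_rec n (\<lambda>p v. set_innermost k (f p v) (g p v))"
  using assms(2) by (induction k arbitrary: g) (simp_all add: total_rec_prod_encode total_rec_fst_decode
      total_rec_innermost assms(1))

section \<open>Rational codes and Cauchy names\<close>

text \<open>
  Doubling encodes a natural number as an integer, since odd codes stand for negative integers.
\<close>

definition rat_code :: "nat \<Rightarrow> nat \<Rightarrow> nat" where
  "rat_code N D = prod_encode (2 * N, 2 * D)"

definition rat_val :: "nat \<Rightarrow> real" where
  "rat_val c = of_rat (nat_to_rat_surj c)"

lemma rat_val_eq:
  "rat_val c = of_int (int_decode (fst (prod_decode c))) / of_int (int_decode (snd (prod_decode c)))"
proof -
  have "of_rat (Fract a b) = (of_int a / of_int b :: real)" for a b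
    by (cases "b = 0") (simp_all add: of_rat_rat rat_number_collapse eq_rat)
  then show ?thesis by (simp add: rat_val_def nat_to_rat_surj_def split: prod.split)
qed

lemma int_decode_double [simp]: "int_decode (2 * n) = int n"
  by (simp add: int_decode_def sum_decode_def)

lemma rat_val_rat_code [simp]: "rat_val (rat_code N D) = real N / real D"
  by (simp add: rat_val_eq rat_code_def)

text \<open>
  The floor of \<open>D\<close> times the coded rational, cut off at 0, in terms of natural numbers. Equal parity of
  the two components means equal sign, and \<open>Suc n div 2\<close> is the absolute value of the integer coded
  by \<open>n\<close>. A zero denominator gives 0 on both sides of the lemma below.
\<close>

definition floor_code :: "nat \<Rightarrow> nat \<Rightarrow> nat" where
  "floor_code D c =
     (if even (fst (prod_decode c)) = even (snd (prod_decode c))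
      then D * (Suc (fst (prod_decode c)) div 2) div (Suc (snd (prod_decode c)) div 2)
      else 0)"

lemma floor_code_eq: "floor_code D c = nat \<lfloor>real D * rat_val c\<rfloor>"
proof -
  have dec: "real_of_int (int_decode n) = (if even n then 1 else -1) * real (Suc n div 2)" for n
    by (cases "even n") (auto simp: int_decode_def sum_decode_def elim!: evenE oddE)
  define a b where "a = fst (prod_decode c)" and "b = snd (prod_decode c)"
  have val: "rat_val c = (if even a = even b then 1 else -1) * (real (Suc a div 2) / real (Suc b div 2))"
  proof -
    define A B where "A = real (Suc a div 2)" and "B = real (Suc b div 2)"
    have "rat_val c = ((if even a then 1 else -1) * A) / ((if even b then 1 else -1) * B)"
      by (simp only: rat_val_eq dec a_def b_def A_def B_def)
    then show ?thesis by (auto simp flip: A_def B_def)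
  qed
  show ?thesis
  proof (cases "even a = even b")
    case True
    have "\<lfloor>real (D * (Suc a div 2)) / real (Suc b div 2)\<rfloor> = int (D * (Suc a div 2) div (Suc b div 2))"
      by (rule floor_divide_of_nat_eq)
    with True show ?thesis by (simp add: floor_code_def val flip: a_def b_def)
  next
    case False
    have "real D * (real (Suc a div 2) / real (Suc b div 2)) \<ge> 0" by simp
    with False have "real D * rat_val c \<le> 0" by (simp add: val)
    then have "\<lfloor>real D * rat_val c\<rfloor> \<le> 0" by (simp add: floor_le_iff)
    with False show ?thesis by (simp add: floor_code_def flip: a_def b_def)
  qed
qed

lemma floor_code_bounds:
  assumes "\<bar>rat_val c - x\<bar> \<le> e" "0 \<le> x" "0 \<le> e"
  shows "real D * (x - e) - 1 < floor_code D c" "floor_code D c \<le> real D * (x + e)"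
proof -
  have 1: "real D * (x - e) \<le> real D * rat_val c" "real D * rat_val c \<le> real D * (x + e)"
    using assms(1) by (intro mult_left_mono; simp)+
  have 2: "0 \<le> real D * (x + e)" using assms by simp
  show "real D * (x - e) - 1 < floor_code D c" "floor_code D c \<le> real D * (x + e)"
    unfolding floor_code_eq using 1 2 by linarith+
qed

text \<open>
  Fixed-point arithmetic with denominator \<open>D\<close> thus loses at most \<open>1 / D\<close>, which keeps all later
  computations on real numbers within the natural numbers.
\<close>

lemma floor_code_approx:
  assumes "\<bar>rat_val c - x\<bar> \<le> e" "0 \<le> x" "0 \<le> e" "0 < D"
  shows "x - e - 1 / D \<le> floor_code D c / D" "floor_code D c / D \<le> x + e"
proof -
  note b = floor_code_bounds[OF assms(1-3), of D]
  have "(real D * (x - e) - 1) / D \<le> floor_code D c / D" "floor_code D c / D \<le> real D * (x + e) / D"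
    using b by (intro divide_right_mono; simp)+
  then show "x - e - 1 / D \<le> floor_code D c / D" "floor_code D c / D \<le> x + e"
    using assms(4) by (simp_all add: diff_divide_distrib)
qed

lemma cauchy_name_iff: "cauchy_name p x \<longleftrightarrow> (\<forall>j. \<bar>rat_val (p j) - x\<bar> \<le> 1 / 2 ^ j)"
  by (simp add: cauchy_name_def rat_val_def)

lemma cauchy_name_unique:
  assumes "cauchy_name p x" "cauchy_name p y"
  shows "x = y"
proof (rule ccontr)
  assume "x \<noteq> y"
  then obtain j where j: "2 * (1 / 2) ^ j < \<bar>x - y\<bar>"
    using real_arch_pow_inv[of "\<bar>x - y\<bar> / 2" "1/2"] by (auto simp: mult.commute)
  define e :: real where "e = (1 / 2) ^ j"
  have "\<bar>rat_val (p j) - x\<bar> \<le> e" "\<bar>rat_val (p j) - y\<bar> \<le> e"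
    using assms by (simp_all add: cauchy_name_iff power_one_over e_def)
  then have "x - y \<le> 2 * e" "y - x \<le> 2 * e" by linarith+
  with j show False unfolding e_def[symmetric] by linarith
qed

lemma rho_eq_Some_iff: "rho p = Some x \<longleftrightarrow> cauchy_name p x"
proof -
  have "(THE x. cauchy_name p x) = x" if "cauchy_name p x" for x
    using that cauchy_name_unique by blast
  then show ?thesis by (auto simp: rho_def)
qed

section \<open>The Cantor set\<close>

text \<open>
  The numerator over \<open>3 ^ n\<close> of the sum of the first \<open>n\<close> terms of \<open>tau b\<close>.
\<close>

primrec tau_num :: "(nat \<Rightarrow> bool) \<Rightarrow> nat \<Rightarrow> nat" where
  "tau_num b 0 = 0"
| "tau_num b (Suc n) = 3 * tau_num b n + 2 * of_bool (b n)"

lemma tau_bounds: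
  "real (tau_num b n) / 3 ^ n \<le> tau b" "tau b \<le> real (tau_num b n) / 3 ^ n + 1 / 3 ^ n"
proof -
  define f :: "nat \<Rightarrow> real" where "f = (\<lambda>i. 2 * of_bool (b i) / 3 ^ (i + 1))"
  define g :: "nat \<Rightarrow> real" where "g = (\<lambda>i. 2 / 3 ^ (i + 1))"
  have fg: "0 \<le> f i" "f i \<le> g i" for i by (auto simp: f_def g_def)
  have gn: "(\<lambda>i. g (i + n)) sums (1 / 3 ^ n)" for n
  proof -
    have "(\<lambda>i. 2 / 3 ^ (n + 1) * (1 / 3 :: real) ^ i) sums (2 / 3 ^ (n + 1) * (1 / (1 - 1 / 3)))"
      by (intro sums_mult geometric_sums) simp
    then show ?thesis by (simp add: g_def power_add power_one_over field_simps)
  qed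
  have "summable g" using gn[of 0] by (simp add: sums_iff)
  then have sf: "summable f" by (rule summable_comparison_test') (use fg in auto)
  have "(\<Sum>i<n. f i) = real (tau_num b n) / 3 ^ n"
    by (induction n) (simp_all add: f_def field_simps)
  then have split: "tau b = (\<Sum>i. f (i + n)) + real (tau_num b n) / 3 ^ n"
    using suminf_split_initial_segment[OF sf, of n] by (simp add: tau_def f_def)
  have sfn: "summable (\<lambda>i. f (i + n))" using sf by simp
  have "0 \<le> (\<Sum>i. f (i + n))" by (rule suminf_nonneg[OF sfn]) (use fg in auto)
  moreover have "(\<Sum>i. f (i + n)) \<le> 1 / 3 ^ n"
    using suminf_le[OF _ sfn, of "\<lambda>i. g (i + n)"] gn[of n] fg by (auto simp: sums_iff)
  ultimately show "real (tau_num b n) / 3 ^ n \<le> tau b" "tau b \<le> real (tau_num b n) / 3 ^ n + 1 / 3 ^ n"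
    unfolding split by linarith+
qed

lemma tau_range: "0 \<le> tau b" "tau b \<le> 1"
  using tau_bounds[of b 0] by simp_all

lemma tau_zero [simp]: "tau (\<lambda>_. False) = 0"
  by (simp add: tau_def)

lemma tau_approx: "\<bar>real (tau_num b n) / 3 ^ n - tau b\<bar> \<le> 1 / 3 ^ n"
  using tau_bounds[of b n] by linarith

lemma one_third_power_le: "1 / 3 ^ n \<le> (1 / 2 ^ n :: real)"
  by (intro divide_left_mono power_mono mult_pos_pos) simp_all

definition tau_name :: "(nat \<Rightarrow> bool) \<Rightarrow> baire" where
  "tau_name b j = rat_code (tau_num b j) (3 ^ j)"

lemma cauchy_name_tau: "cauchy_name (tau_name b) (tau b)"
  unfolding cauchy_name_iff
proof
  fix j
  show "\<bar>rat_val (tau_name b j) - tau b\<bar> \<le> 1 / 2 ^ j"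
    using tau_approx[of b j] one_third_power_le[of j] by (simp add: tau_name_def)
qed

text \<open>
  With \<open>t / 3 ^ n\<close> the sum of the first \<open>n\<close> terms, the real \<open>3 ^ (n + 1) * tau b\<close> lies in
  \<open>[3 * t, 3 * t + 1]\<close> if bit \<open>n\<close> is 0 and in \<open>[3 * t + 2, 3 * t + 3]\<close> if it is 1. The threshold is
  the midpoint \<open>3 * t + 3 / 2\<close> of the gap, multiplied by 4.
\<close>

definition next_bit :: "baire \<Rightarrow> nat \<Rightarrow> nat \<Rightarrow> bool" where
  "next_bit q n t \<longleftrightarrow> 12 * t + 6 \<le> floor_code (4 * 3 ^ Suc n) (q (2 * n + 5))"

primrec decode_num :: "baire \<Rightarrow> nat \<Rightarrow> nat" where
  "decode_num q 0 = 0"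
| "decode_num q (Suc n) = 3 * decode_num q n + 2 * of_bool (next_bit q n (decode_num q n))"

definition decode_bit :: "baire \<Rightarrow> nat \<Rightarrow> bool" where
  "decode_bit q n = next_bit q n (decode_num q n)"

text \<open>
  The name is read at precision \<open>2 ^ - (2 * n + 5)\<close>. On the scale \<open>3 ^ (n + 1)\<close>, this is an error of at
  most 1/8 because \<open>3 ^ (n + 1) \<le> 4 ^ (n + 1)\<close>, and rounding adds at most 1/4; half the width of the gap
  is 1/2.
\<close>

lemma next_bit_iff:
  assumes "cauchy_name q (tau b)"
  shows "next_bit q n (tau_num b n) \<longleftrightarrow> b n"
proof -
  define X where "X = 3 ^ Suc n * tau b"
  define A where "A = floor_code (4 * 3 ^ Suc n) (q (2 * n + 5))"
  define e :: real where "e = 1 / 2 ^ (2 * n + 5)"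
  have "real (3 ^ Suc n) * e \<le> 1 / 8"
  proof -
    have "(3::real) ^ Suc n \<le> 4 ^ Suc n" by (intro power_mono) auto
    also have "(4::real) ^ Suc n = 2 ^ (2 * n + 5) / 8"
      by (simp add: power_add power_mult)
    finally show ?thesis by (simp add: e_def field_simps)
  qed
  moreover have "real (4 * 3 ^ Suc n) * (tau b - e) - 1 < A" "A \<le> real (4 * 3 ^ Suc n) * (tau b + e)"
    using assms tau_range[of b] unfolding A_def
    by (intro floor_code_bounds; simp add: cauchy_name_iff e_def)+
  ultimately have A: "4 * X - 3 / 2 \<le> A" "A \<le> 4 * X + 1 / 2"
    by (simp_all add: X_def algebra_simps)
  have X: "real (tau_num b (Suc n)) \<le> X" "X \<le> real (tau_num b (Suc n)) + 1"
    using tau_bounds[of b "Suc n"] by (simp_all add: X_def field_simps)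
  show ?thesis
  proof (cases "b n")
    case True
    then have "real A \<ge> real (12 * tau_num b n + 6)" using A X by simp
    with True show ?thesis unfolding next_bit_def A_def[symmetric] by linarith
  next
    case False
    then have "real A < real (12 * tau_num b n + 6)" using A X by simp
    with False show ?thesis unfolding next_bit_def A_def[symmetric] by linarith
  qed
qed

lemma decode_bit_tau:
  assumes "cauchy_name q (tau b)"
  shows "decode_bit q = b"
proof -
  have "decode_num q n = tau_num b n" for n
    by (induction n) (simp_all add: next_bit_iff[OF assms])
  then show ?thesis by (simp add: decode_bit_def next_bit_iff[OF assms] fun_eq_iff)
qed

lemma tau_inject: "tau b = tau b' \<longleftrightarrow> b = b'"
  using decode_bit_tau[OF cauchy_name_tau] decode_bit_tau[of "tau_name b" b'] cauchy_name_tau[of b]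
  by metis

section \<open>Decoding blocks\<close>

definition block_end :: "baire \<Rightarrow> nat \<Rightarrow> nat" where
  "block_end p k = (\<Sum>l<k. Suc (p l))"

lemma block_end_simps [simp]:
  "block_end p 0 = 0" "block_end p (Suc k) = block_end p k + Suc (p k)"
  by (simp_all add: block_end_def)

lemma strict_mono_block_end: "strict_mono (block_end p)"
  by (simp add: strict_mono_Suc_iff)

lemma block_end_less_iff: "block_end p i < block_end p j \<longleftrightarrow> i < j"
  and block_end_le_iff: "block_end p i \<le> block_end p j \<longleftrightarrow> i \<le> j"
  by (rule strict_mono_less strict_mono_less_eq, rule strict_mono_block_end)+

text \<open>
  Position \<open>n\<close> belongs to the first block that ends beyond it, and only the last bit of a block is a
  one.
\<close>

lemma blocks_iff: "blocks p n \<longleftrightarrow> (\<exists>i<Suc n. Suc n = block_end p (Suc i))"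
proof -
  define W where "W k = concat (map (\<lambda>i. replicate (p i) False @ [True]) [0..<k])" for k
  have W: "length (W k) = block_end p k" "W (Suc k) = W k @ replicate (p k) False @ [True]" for k
    by (induction k) (simp_all add: W_def)
  have "W k ! n \<longleftrightarrow> (\<exists>i<k. Suc n = block_end p (Suc i))" if "n < block_end p k" for k
    using that
  proof (induction k)
    case (Suc k)
    show ?case
    proof (cases "n < block_end p k")
      case True
      then have "Suc n \<noteq> block_end p (Suc k)" by simp
      with Suc.IH[OF True] True show ?thesis
        by (simp add: W nth_append less_Suc_eq del: block_end_simps) blast
    next
      case False
      have "Suc n \<noteq> block_end p (Suc i)" if "i < k" for i
        using that False block_end_le_iff[of p "Suc i" k] by (simp del: block_end_simps)
      moreover have "W (Suc k) ! n \<longleftrightarrow> n = block_end p k + p k"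
        using False Suc.prems by (auto simp: W nth_append nth_Cons')
      ultimately show ?thesis by (auto simp: less_Suc_eq)
    qed
  qed simp
  moreover have "n < block_end p (Suc n)"
    using strict_mono_imp_increasing[OF strict_mono_block_end, of "Suc n" p] by (simp del: block_end_simps)
  ultimately show ?thesis unfolding blocks_def W_def[symmetric] by blast
qed

lemma blocks_cong: "(\<And>l. l \<le> n \<Longrightarrow> p l = q l) \<Longrightarrow> blocks p n = blocks q n"
  unfolding blocks_iff block_end_def by (intro ex_cong1 conj_cong refl arg_cong2[of _ _ _ _ "(=)"] sum.cong) auto

definition count_ones :: "(nat \<Rightarrow> bool) \<Rightarrow> nat \<Rightarrow> nat" where
  "count_ones b n = (\<Sum>m<n. of_bool (b m))"

lemma count_ones_blocks: "count_ones (blocks p) n = card {i. block_end p (Suc i) \<le> n}"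
proof -
  have "count_ones (blocks p) n = card {m. m < n \<and> blocks p m}"
    by (simp add: count_ones_def Collect_conj_eq lessThan_def)
  also have "\<dots> = card {i. block_end p (Suc i) \<le> n}"
  proof (rule bij_betw_same_card[symmetric], rule bij_betw_imageI)
    show "inj_on (\<lambda>i. block_end p (Suc i) - 1) {i. block_end p (Suc i) \<le> n}"
    proof (rule inj_onI)
      fix i j assume "block_end p (Suc i) - 1 = block_end p (Suc j) - 1"
      then have "block_end p (Suc i) = block_end p (Suc j)" by simp
      then show "i = j" using strict_mono_eq[OF strict_mono_block_end, of p "Suc i" "Suc j"] by simp
    qed
    show "(\<lambda>i. block_end p (Suc i) - 1) ` {i. block_end p (Suc i) \<le> n} = {m. m < n \<and> blocks p m}"
      (is "?f ` ?A = ?B")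
    proof (intro set_eqI iffI)
      fix m assume "m \<in> ?f ` ?A"
      then obtain i where i: "block_end p (Suc i) \<le> n" "Suc m = block_end p (Suc i)" by auto
      have "Suc i \<le> block_end p (Suc i)"
        by (rule strict_mono_imp_increasing[OF strict_mono_block_end])
      with i have "i < Suc m" by linarith
      with i show "m \<in> ?B" unfolding blocks_iff by force
    next
      fix m assume "m \<in> ?B"
      then obtain i where "m < n" "Suc m = block_end p (Suc i)" unfolding blocks_iff by blast
      then show "m \<in> ?f ` ?A" by (intro image_eqI[of _ _ i]; simp del: block_end_simps)
    qed
  qed
  finally show ?thesis .
qed

text \<open>
  The number of ones reaches \<open>k\<close> right after the end of block number \<open>k - 1\<close>, so a search for this
  event recovers the block ends from the bit sequence.
\<close>

lemma Least_count_ones_blocks: "(LEAST n. count_ones (blocks p) n = k) = block_end p k"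
  and count_ones_block_end: "count_ones (blocks p) (block_end p k) = k"
proof -
  have "count_ones (blocks p) n < k" if n: "n < block_end p k" for n
  proof -
    obtain k' where k: "k = Suc k'" using n by (cases k) auto
    have "{i. block_end p (Suc i) \<le> n} \<subseteq> {..<k'}"
    proof
      fix i assume "i \<in> {i. block_end p (Suc i) \<le> n}"
      then have "block_end p (Suc i) < block_end p (Suc k')" using n unfolding k by simp
      then show "i \<in> {..<k'}" unfolding block_end_less_iff by simp
    qed
    then have "card {i. block_end p (Suc i) \<le> n} \<le> card {..<k'}" by (intro card_mono) auto
    then show ?thesis unfolding count_ones_blocks k by simp
  qed
  moreover have "{i. block_end p (Suc i) \<le> block_end p k} = {..<k}"
    unfolding block_end_le_iff by auto
  then show *: "count_ones (blocks p) (block_end p k) = k"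
    by (simp add: count_ones_blocks del: block_end_simps)
  ultimately show "(LEAST n. count_ones (blocks p) n = k) = block_end p k"
    by (intro Least_equality) (auto intro: leI)
qed

definition decode_kappa :: "baire \<rightharpoonup> baire" where
  "decode_kappa q =
     Option.bind (search (count_ones (decode_bit q))) (\<lambda>s. Some (\<lambda>i. s (Suc i) - s i - 1))"

text \<open>
  The differences of successive block ends, diminished by one, are the entries of \<open>p\<close>. Hence
  \<open>kappa\<close> is injective with a computable inverse on names.
\<close>

lemma decode_kappa:
  assumes "cauchy_name q (kappa p)"
  shows "decode_kappa q = Some p"
  using decode_bit_tau[of q "blocks p"] assms count_ones_block_end
  by (auto simp: decode_kappa_def kappa_def search_def Least_count_ones_blocks)

lemma kappa_inject: "kappa p = kappa q \<longleftrightarrow> p = q"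
  using decode_kappa[of "tau_name (blocks p)"] cauchy_name_tau[of "blocks p"]
  by (metis kappa_def option.inject)


section \<open>Computing with names\<close>

text \<open>
  Needed where an expression is used below a binder whose variable it does not mention.
\<close>

lemma total_rec_weaken:
  assumes "total_rec n f"
  shows "total_rec (Suc n) (\<lambda>p v. f p (\<lambda>i. v (Suc i)))"
proof -
  obtain e where e: "\<And>p xs. length xs = n \<Longrightarrow> run e p xs = Some (f p ((!) xs))"
    using assms unfolding total_rec_def by auto
  have "run (Comp e (map Proj [1..<Suc n])) p xs = Some (f p (\<lambda>i. xs ! Suc i))"
    if l: "length xs = Suc n" for p xs
  proof -
    obtain x zs where xs: "xs = x # zs" "length zs = n"
      using l by (metis length_Suc_conv)
    have "list_all2 (\<lambda>g y. run g p xs = Some y) (map Proj [1..<Suc n]) zs"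
      using xs by (auto simp: list_all2_conv_all_nth simp del: upt_Suc)
    from run_Comp[OF this] show ?thesis using xs by (simp add: e)
  qed
  then show ?thesis by (rule total_recI)
qed

lemma total_rec_rat_code [rec_intros]:
  "total_rec n f \<Longrightarrow> total_rec n g \<Longrightarrow> total_rec n (\<lambda>p v. rat_code (f p v) (g p v))"
  unfolding rat_code_def by (intro rec_intros)

lemma total_rec_floor_code [rec_intros]:
  assumes "total_rec n f" "total_rec n g"
  shows "total_rec n (\<lambda>p v. floor_code (f p v) (g p v))"
proof -
  have "even x = even y \<longleftrightarrow> \<not> (even x \<and> \<not> even y) \<and> \<not> (\<not> even x \<and> even y)" for x y :: nat by blast
  then show ?thesis unfolding floor_code_def by (simp only:) (intro rec_intros assms)
qed

lemma total_rec_tau_num [rec_intros]: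
  assumes "decidable_rel (Suc n) (\<lambda>p v. B p (\<lambda>i. v (Suc i)) (v 0))" "total_rec n k"
  shows "total_rec n (\<lambda>p v. tau_num (B p v) (k p v))"
proof -
  have "tau_num b k = rec_nat 0 (\<lambda>m y. 3 * y + 2 * of_bool (b m)) k" for b k
    by (induction k) auto
  then show ?thesis by (simp only:) (intro rec_intros assms total_rec_insert_var; simp)
qed

lemma total_rec_count_ones [rec_intros]:
  assumes "decidable_rel (Suc n) (\<lambda>p v. B p (\<lambda>i. v (Suc i)) (v 0))" "total_rec n k"
  shows "total_rec n (\<lambda>p v. count_ones (B p v) (k p v))"
  unfolding count_ones_def by (intro rec_intros assms)

lemma decidable_rel_blocks [rec_intros]:
  assumes "total_rec (Suc n) (\<lambda>p v. q p (\<lambda>i. v (Suc i)) (v 0))" "total_rec n k"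
  shows "decidable_rel n (\<lambda>p v. blocks (q p v) (k p v))"
  unfolding blocks_iff block_end_def
  by (intro rec_intros total_rec_insert_var assms total_rec_weaken; simp)

lemma decidable_rel_decode_bit:
  assumes "total_rec n k"
  shows "decidable_rel n (\<lambda>q v. decode_bit q (k q v))"
proof (rule total_rec_comp1[OF _ assms])
  have "decode_num q k = rec_nat 0 (\<lambda>m y. 3 * y + 2 * of_bool (next_bit q m y)) k" for q k
    by (induction k) auto
  then show "decidable_rel 1 (\<lambda>q v. decode_bit q (v 0))"
    unfolding decode_bit_def
    by (simp only:) (unfold next_bit_def, intro rec_intros; simp)
qed

lemma computable_decode_kappa: "computable decode_kappa"
proof -
  have "computable (\<lambda>q. Some (count_ones (decode_bit q)))"
    by (rule computable_total) (intro rec_intros decidable_rel_decode_bit; simp)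
  moreover have "computable (\<lambda>s. Some (\<lambda>i. s (Suc i) - s i - 1))"
    by (rule computable_total) (intro rec_intros; simp)
  ultimately have "computable (\<lambda>q. Option.bind (Option.bind (Some (count_ones (decode_bit q))) search)
      (\<lambda>s. Some (\<lambda>i. s (Suc i) - s i - 1)))"
    by (intro computable_bind computable_search)
  then show ?thesis by (simp add: decode_kappa_def[abs_def])
qed

section \<open>Realizers of the represented problems\<close>

lemma kappa_range: "0 \<le> kappa p" "kappa p \<le> 1"
  by (simp_all add: kappa_def tau_range)

lemma table_inject: "table (p, b) = table (p', b') \<longleftrightarrow> p = p' \<and> b = b'"
proof
  assume *: "table (p, b) = table (p', b')"
  from fun_cong[OF *, of 0] have "p = p'" by (simp add: table_def kappa_inject)
  moreover have "b n = b' n" for n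
    using fun_cong[OF *, of "Suc n"] by (simp add: table_def of_bool_eq_iff)
  ultimately show "p = p' \<and> b = b'" by auto
qed simp

lemma D_starD:
  assumes "p \<in> D_star k"
  obtains q where "LimB_iter k p = Some q" "cauchy_name q (r_val k p)" "r_val k p \<in> {1/3..2/3}"
proof -
  from assms obtain q x where "LimB_iter k p = Some q" "rho q = Some x"
    by (auto simp: D_star_def dom_def map_comp_Some_iff)
  moreover from this have "r_val k p = x" by (simp add: r_val_def)
  moreover have "r_val k p \<in> {1/3..2/3}" using assms by (simp add: D_star_def)
  ultimately show ?thesis using that by (simp add: rho_eq_Some_iff)
qed

lemma D_starI:
  assumes "LimB_iter k p = Some q" "cauchy_name q x" "x \<in> {1/3..2/3}"
  shows "p \<in> D_star k" "r_val k p = x"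
proof -
  have *: "(rho \<circ>\<^sub>m LimB_iter k) p = Some x"
    using assms(1,2) by (simp add: map_comp_Some_iff rho_eq_Some_iff)
  then show "r_val k p = x" by (simp add: r_val_def)
  with * assms(3) show "p \<in> D_star k" by (auto simp: D_star_def)
qed

lemma Xi_range: "p \<in> D_star k \<Longrightarrow> Xi k (p, b) \<in> {0..1}"
  using tau_range[of b] by (auto simp: D_star_def Xi_def t_val_def ell_def)

definition table_name :: "baire \<Rightarrow> baire \<Rightarrow> (nat \<Rightarrow> bool) \<Rightarrow> bool" where
  "table_name Q p b \<longleftrightarrow> cauchy_name (\<lambda>j. Q (prod_encode (0, j))) (kappa p) \<and>
     (\<forall>n. cauchy_name (\<lambda>j. Q (prod_encode (Suc n, j))) (of_bool (b n)))"

lemma sequence_rep_table: "sequence_rep rho Q = Some (table (p, b)) \<longleftrightarrow> table_name Q p b"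
proof -
  have *: "sequence_rep rho Q = Some u \<longleftrightarrow> (\<forall>n. rho (\<lambda>j. Q (prod_encode (n, j))) = Some (u n))" for u
  proof (cases "\<exists>w. \<forall>n. rho (\<lambda>j. Q (prod_encode (n, j))) = Some (w n)")
    case True
    then obtain w where "\<And>n. rho (\<lambda>j. Q (prod_encode (n, j))) = Some (w n)" by blast
    then show ?thesis by (simp add: sequence_rep_def dom_def fun_eq_iff)
  next
    case False
    then have "\<not> (\<forall>n. \<exists>x. rho (\<lambda>j. Q (prod_encode (n, j))) = Some x)" by metis
    with False show ?thesis unfolding sequence_rep_def dom_def by auto
  qed
  show ?thesis
    unfolding * rho_eq_Some_iff table_name_def table_def by (auto split: nat.splits)
qed

lemma in_rep_Xi_hat:
  "in_rep (Xi_hat k) Q = Some u \<longleftrightarrow> (\<exists>p b. p \<in> D_star k \<and> u = table (p, b) \<and> table_name Q p b)"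
  unfolding sequence_rep_table[symmetric]
  by (auto simp: Xi_hat_def Omega_star_def subspace_rep_def map_comp_Some_iff restrict_map_def split: if_splits)

lemma out_rep_Xi_hat: "out_rep (Xi_hat k) q = Some y \<longleftrightarrow> cauchy_name q y \<and> y \<in> {0..1}"
  by (auto simp: Xi_hat_def subspace_rep_def map_comp_Some_iff restrict_map_def rho_eq_Some_iff
      split: if_splits)

lemma solutions_Xi_hat: "p \<in> D_star k \<Longrightarrow> solutions (Xi_hat k) (table (p, b)) = {Xi k (p, b)}"
  by (auto simp: Xi_hat_def Omega_star_def table_inject)

text \<open>
  Tables determine \<open>(p, b)\<close> and the value \<open>Xi k (p, b)\<close> always lies in the unit interval, so realizing
  the problem amounts to a statement about names in which tables no longer occur.
\<close>

lemma realizes_Xi_hat_iff: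
  "realizes G (Xi_hat k) \<longleftrightarrow>
     (\<forall>Q p b. p \<in> D_star k \<longrightarrow> table_name Q p b \<longrightarrow>
        (\<exists>q. G Q = Some q \<and> cauchy_name q (Xi k (p, b))))"
proof (intro iffI allI impI)
  fix Q p b
  assume "realizes G (Xi_hat k)" and p: "p \<in> D_star k" and "table_name Q p b"
  moreover from this have "in_rep (Xi_hat k) Q = Some (table (p, b))"
    unfolding in_rep_Xi_hat by blast
  ultimately obtain q y where "G Q = Some q" "out_rep (Xi_hat k) q = Some y"
    "y \<in> solutions (Xi_hat k) (table (p, b))"
    by (elim realizesD) (auto simp: solutions_Xi_hat)
  with p show "\<exists>q. G Q = Some q \<and> cauchy_name q (Xi k (p, b))"
    by (simp add: solutions_Xi_hat out_rep_Xi_hat)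
next
  assume *: "\<forall>Q p b. p \<in> D_star k \<longrightarrow> table_name Q p b \<longrightarrow>
    (\<exists>q. G Q = Some q \<and> cauchy_name q (Xi k (p, b)))"
  show "realizes G (Xi_hat k)"
    unfolding realizes_def
  proof (intro allI impI, elim conjE)
    fix Q u assume "in_rep (Xi_hat k) Q = Some u"
    then obtain p b where pb: "p \<in> D_star k" "u = table (p, b)" "table_name Q p b"
      unfolding in_rep_Xi_hat by blast
    with * obtain q where "G Q = Some q" "cauchy_name q (Xi k (p, b))" by blast
    with pb Xi_range[of p k b]
    show "\<exists>q y. G Q = Some q \<and> out_rep (Xi_hat k) q = Some y \<and> y \<in> solutions (Xi_hat k) u"
      by (intro exI[of _ q] exI[of _ "Xi k (p, b)"]) (simp add: solutions_Xi_hat out_rep_Xi_hat)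
  qed
qed

lemma realizes_Lim_problem_iff:
  "realizes G (Lim_problem k) \<longleftrightarrow> (\<forall>P q. LimB_iter k P = Some q \<longrightarrow> G P = Some q)"
  by (simp add: realizes_def Lim_problem_def baire_problem_def) (metis not_None_eq)

section \<open>Evaluation with iterated limits\<close>

text \<open>
  A rational within 1/4 of 0 or 1 tells which of them it approximates.
\<close>

definition bits_of_table :: "baire \<Rightarrow> nat \<Rightarrow> bool" where
  "bits_of_table Q n \<longleftrightarrow> 2 \<le> floor_code 4 (Q (prod_encode (Suc n, 2)))"

lemma bits_of_table:
  assumes "table_name Q p b"
  shows "bits_of_table Q = b"
proof
  fix n
  define c where "c = Q (prod_encode (Suc n, 2))"
  have "cauchy_name (\<lambda>j. Q (prod_encode (Suc n, j))) (of_bool (b n))"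
    using assms by (simp add: table_name_def)
  then have "\<bar>rat_val c - of_bool (b n)\<bar> \<le> 1 / 4"
    unfolding cauchy_name_iff c_def by (auto dest: spec[of _ 2])
  from floor_code_bounds[OF this, of 4] show "bits_of_table Q n = b n"
    unfolding bits_of_table_def c_def[symmetric] by (cases "b n") auto
qed

definition Xi_digit :: "(nat \<Rightarrow> bool) \<Rightarrow> nat \<Rightarrow> nat \<Rightarrow> nat" where
  "Xi_digit b j c = rat_code (2 * 3 ^ j + tau_num b j + 2 * floor_code (3 ^ j) c) (8 * 3 ^ j)"

text \<open>
  In \<open>1 / 4 + tau b / 8 + r / 4\<close>, the errors of at most \<open>1 / 3 ^ j\<close> for \<open>tau b\<close> and
  \<open>1 / 2 ^ j + 1 / 3 ^ j\<close> for \<open>r\<close> are scaled down by 8 and 4, which leaves less than \<open>1 / 2 ^ j\<close>.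
  The \<open>j\<close>-th entry of the result depends on \<open>q\<close> only through its \<open>j\<close>-th entry.
\<close>

lemma cauchy_name_Xi:
  assumes "cauchy_name q r" "0 \<le> r"
  shows "cauchy_name (\<lambda>j. Xi_digit b j (q j)) (t_val b + ell * r)"
  unfolding cauchy_name_iff
proof
  fix j
  define D :: real where "D = 3 ^ j"
  define A where "A = real (floor_code (3 ^ j) (q j))"
  define T where "T = real (tau_num b j)"
  define e :: real where "e = 1 / 2 ^ j"
  define a t d where "a = A / D" and "t = T / D" and "d = 1 / D"
  have D: "D > 0" "d \<le> e"
    using one_third_power_le[of j] by (simp_all add: D_def d_def e_def)
  have a: "r - e - d \<le> a" "a \<le> r + e"
    using floor_code_approx[of "q j" r e "3 ^ j"] assms
    by (simp_all add: cauchy_name_iff a_def A_def D_def d_def e_def)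
  have t: "t \<le> tau b" "tau b \<le> t + d"
    using tau_bounds[of b j] by (simp_all add: t_def d_def T_def D_def)
  have "rat_val (Xi_digit b j (q j)) = (2 * D + T + 2 * A) / (8 * D)"
    by (simp add: Xi_digit_def A_def T_def D_def)
  also have "\<dots> = 1 / 4 + 1 / 8 * t + 1 / 4 * a" using D(1) by (simp add: a_def t_def field_simps)
  finally have "rat_val (Xi_digit b j (q j)) - (t_val b + ell * r) = ((t - tau b) + 2 * (a - r)) / 8"
    by (simp add: t_val_def ell_def)
  moreover have "(t - tau b) + 2 * (a - r) \<le> 8 * e" "- (8 * e) \<le> (t - tau b) + 2 * (a - r)"
    using a t D(2) by argo+
  ultimately show "\<bar>rat_val (Xi_digit b j (q j)) - (t_val b + ell * r)\<bar> \<le> 1 / 2 ^ j"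
    unfolding e_def[symmetric] by (simp add: abs_le_iff)
qed

lemma total_rec_Xi_digit [rec_intros]:
  assumes "decidable_rel (Suc n) (\<lambda>p v. B p (\<lambda>i. v (Suc i)) (v 0))" "total_rec n j" "total_rec n c"
  shows "total_rec n (\<lambda>p v. Xi_digit (B p v) (j p v) (c p v))"
  unfolding Xi_digit_def by (intro rec_intros assms)

definition first_column :: "baire \<Rightarrow> baire" where
  "first_column Q j = Q (prod_encode (0, j))"

lemma computable_decode_table: "computable (\<lambda>Q. decode_kappa (first_column Q))"
proof -
  have "computable (\<lambda>Q. Some (first_column Q))"
    unfolding first_column_def by (rule computable_total) (intro rec_intros; simp)
  from computable_bind[OF this computable_decode_kappa] show ?thesis by simp
qed

lemma decode_table: "table_name Q p b \<Longrightarrow> decode_kappa (first_column Q) = Some p"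
  by (intro decode_kappa) (simp add: table_name_def first_column_def[abs_def])

text \<open>
  After decoding \<open>p\<close>, the final arithmetic is carried out on the entries of \<open>p\<close> before the limits are
  taken. The bits of \<open>b\<close> are available without any limit.
\<close>

lemma Xi_hat_by_limits:
  "\<exists>K. computable K \<and> realizes (LimB_iter k \<circ>\<^sub>m K) (Xi_hat k)"
proof -
  define H where "H w = (\<lambda>i. Xi_digit (bits_of_table (\<lambda>n. w (2 * n))) (innermost k i) (w (2 * i + 1)))"
    for w :: baire
  define K where "K Q = Option.bind (decode_kappa (first_column Q)) (\<lambda>p. Some (H (join Q p)))" for Q
  have "computable (\<lambda>w. Some (H w))"
    unfolding H_def bits_of_table_def by (rule computable_total) (intro rec_intros; simp)
  from computable_bind[OF computable_join[OF computable_id computable_decode_table] this]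
  have "computable K" by (rule computable_restrict) (auto simp: K_def bind_eq_Some_conv)
  moreover have "realizes (LimB_iter k \<circ>\<^sub>m K) (Xi_hat k)"
    unfolding realizes_Xi_hat_iff
  proof (intro allI impI)
    fix Q p b assume p: "p \<in> D_star k" and Q: "table_name Q p b"
    obtain q where q: "LimB_iter k p = Some q" "cauchy_name q (r_val k p)" "r_val k p \<in> {1/3..2/3}"
      using D_starD[OF p] .
    have "finite_use (\<lambda>q. Xi_digit b j (q j))" for j by (rule finite_useI[of "Suc j"]) simp
    from LimB_iter_lift[OF q(1), of "\<lambda>q j. Xi_digit b j (q j)", OF this]
    have "LimB_iter k (\<lambda>i. Xi_digit b (innermost k i) (p i)) = Some (\<lambda>j. Xi_digit b j (q j))"
      by simp
    moreover have "K Q = Some (\<lambda>i. Xi_digit b (innermost k i) (p i))"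
      using bits_of_table[OF Q] by (simp add: K_def decode_table[OF Q] H_def)
    moreover have "cauchy_name (\<lambda>j. Xi_digit b j (q j)) (Xi k (p, b))"
      using cauchy_name_Xi[OF q(2)] q(3) by (simp add: Xi_def)
    ultimately show "\<exists>q. (LimB_iter k \<circ>\<^sub>m K) Q = Some q \<and> cauchy_name q (Xi k (p, b))"
      by (simp add: map_comp_Some_iff)
  qed
  ultimately show ?thesis by blast
qed

text \<open>
  Decode \<open>p\<close>, ask for its \<open>k\<close>-fold limit, and do the arithmetic on the answer.
\<close>

lemma Xi_hat_le_Lim: "Xi_hat k \<le>\<^sub>W Lim_problem k"
proof (rule weihrauch_leI)
  define H where "H w = (\<lambda>j. Xi_digit (bits_of_table (\<lambda>n. w (2 * n))) j (w (2 * j + 1)))"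
    for w :: baire
  show "computable (\<lambda>Q. decode_kappa (first_column Q))" by (rule computable_decode_table)
  show "computable (\<lambda>w. Some (H w))"
    unfolding H_def bits_of_table_def by (rule computable_total) (intro rec_intros; simp)
  fix G Q u
  assume G: "realizes G (Lim_problem k)" and "in_rep (Xi_hat k) Q = Some u"
  from this(2) obtain p b where p: "p \<in> D_star k" and u: "u = table (p, b)" and Q: "table_name Q p b"
    unfolding in_rep_Xi_hat by blast
  obtain q where q: "LimB_iter k p = Some q" "cauchy_name q (r_val k p)" "r_val k p \<in> {1/3..2/3}"
    using D_starD[OF p] .
  have "G p = Some q" using G q(1) by (simp add: realizes_Lim_problem_iff)
  moreover have "H (join Q q) = (\<lambda>j. Xi_digit b j (q j))"
    using bits_of_table[OF Q] by (simp add: H_def)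
  moreover have "cauchy_name (\<lambda>j. Xi_digit b j (q j)) (Xi k (p, b))"
    using cauchy_name_Xi[OF q(2)] q(3) by (simp add: Xi_def)
  ultimately show "\<exists>p q' s y. decode_kappa (first_column Q) = Some p \<and> G p = Some q'
      \<and> Some (H (join Q q')) = Some s \<and> out_rep (Xi_hat k) s = Some y \<and> y \<in> solutions (Xi_hat k) u"
    using decode_table[OF Q] Xi_range[OF p, of b]
    by (intro exI[of _ p] exI[of _ q] exI[of _ "\<lambda>j. Xi_digit b j (q j)"] exI[of _ "Xi k (p, b)"])
      (simp add: u solutions_Xi_hat[OF p] out_rep_Xi_hat)
qed

section \<open>Coding iterated limits into a real number\<close>

definition name_of_table :: "baire \<Rightarrow> baire" where
  "name_of_table p i = (if fst (prod_decode i) = 0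
     then tau_name (blocks p) (snd (prod_decode i)) else rat_code 0 1)"

lemma table_name_of_table: "table_name (name_of_table p) p (\<lambda>_. False)"
  using cauchy_name_tau[of "blocks p"]
  by (simp add: table_name_def name_of_table_def kappa_def cauchy_name_iff)

lemma total_rec_tau_name [rec_intros]:
  assumes "decidable_rel (Suc n) (\<lambda>p v. B p (\<lambda>i. v (Suc i)) (v 0))" "total_rec n j"
  shows "total_rec n (\<lambda>p v. tau_name (B p v) (j p v))"
  unfolding tau_name_def by (intro rec_intros assms)

lemma total_rec_name_of_table:
  assumes "total_rec (Suc n) (\<lambda>p v. q p (\<lambda>i. v (Suc i)) (v 0))" "total_rec n i"
  shows "total_rec n (\<lambda>p v. name_of_table (q p v) (i p v))"
  unfolding name_of_table_def by (intro rec_intros assms total_rec_insert_var; simp)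

text \<open>
  A name of \<open>1 / 3 + kappa q / 3\<close>, the image of \<open>kappa q\<close> under the affine map from the unit interval
  onto the interval in which \<open>r_val\<close> has to lie.
\<close>

definition coded_real_name :: "baire \<Rightarrow> baire" where
  "coded_real_name q j = rat_code (3 ^ j + tau_num (blocks q) j) (3 * 3 ^ j)"

lemma cauchy_name_coded_real: "cauchy_name (coded_real_name q) (1 / 3 + kappa q / 3)"
  unfolding cauchy_name_iff
proof
  fix j
  define t where "t = real (tau_num (blocks q) j) / 3 ^ j"
  have "rat_val (coded_real_name q j) = 1 / 3 + t / 3"
    by (simp add: coded_real_name_def add_divide_distrib t_def)
  then have "rat_val (coded_real_name q j) - (1 / 3 + kappa q / 3) = (t - kappa q) / 3"
    by (simp add: diff_divide_distrib)
  moreover have "\<bar>t - kappa q\<bar> \<le> 1 / 2 ^ j"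
    using tau_approx[of "blocks q" j] one_third_power_le[of j] by (simp add: t_def kappa_def)
  ultimately show "\<bar>rat_val (coded_real_name q j) - (1 / 3 + kappa q / 3)\<bar> \<le> 1 / 2 ^ j"
    by simp
qed

lemma tau_num_blocks_cong:
  "(\<And>m. m < j \<Longrightarrow> q' m = q m) \<Longrightarrow> tau_num (blocks q') j = tau_num (blocks q) j"
proof (induction j)
  case (Suc j)
  moreover have "blocks q' j = blocks q j" by (rule blocks_cong) (simp add: Suc.prems)
  ultimately show ?case by simp
qed simp

lemma finite_use_coded_real_name: "finite_use (\<lambda>q. coded_real_name q j)"
  by (rule finite_useI[of j]) (simp add: coded_real_name_def cong: tau_num_blocks_cong)

lemma finite_use_name_of_table: "finite_use (\<lambda>q. name_of_table q i)"
  by (rule finite_useI[of "snd (prod_decode i)"])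
    (simp add: name_of_table_def tau_name_def cong: tau_num_blocks_cong)

text \<open>
  A name of \<open>12 * y - 4\<close>, from a name of a real number \<open>y\<close>. The five additional binary digits of
  precision absorb the factor 12.
\<close>

definition rescale :: "baire \<Rightarrow> baire" where
  "rescale y j = rat_code (12 * floor_code (2 ^ (j + 5)) (y (j + 5)) - 4 * 2 ^ (j + 5)) (2 ^ (j + 5))"

lemma cauchy_name_rescale:
  assumes "cauchy_name y (1 / 3 + x / 12)" "0 \<le> x"
  shows "cauchy_name (rescale y) x"
  unfolding cauchy_name_iff
proof
  fix j
  define N where "N = floor_code (2 ^ (j + 5)) (y (j + 5))"
  define D :: nat where "D = 2 ^ (j + 5)"
  define A where "A = real N / real D"
  define e :: real where "e = 1 / 2 ^ j"
  have D: "real D > 0" "1 / real D = e / 32" by (simp_all add: D_def e_def power_add)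
  have A: "1 / 3 + x / 12 - e / 16 \<le> A" "A \<le> 1 / 3 + x / 12 + e / 32"
    using floor_code_approx[of "y (j + 5)" "1 / 3 + x / 12" "1 / D" D] assms D
    by (simp_all add: cauchy_name_iff A_def N_def D_def)
  have r: "rescale y j = rat_code (12 * N - 4 * D) D"
    by (simp add: rescale_def N_def D_def)
  have "real (12 * N - 4 * D) = max 0 (12 * real N - 4 * real D)" by (simp add: of_nat_diff_real)
  also have "12 * real N - 4 * real D = real D * (12 * A - 4)"
    using D(1) by (simp add: A_def right_diff_distrib)
  also have "max 0 (real D * (12 * A - 4)) = real D * max 0 (12 * A - 4)"
    using D(1) by (simp add: max_mult_distrib_left)
  finally have "rat_val (rescale y j) = max 0 (12 * A - 4)"
    using D(1) by (simp add: r)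
  moreover have "e \<ge> 0" by (simp add: e_def)
  ultimately show "\<bar>rat_val (rescale y j) - x\<bar> \<le> 1 / 2 ^ j"
    using A assms(2) unfolding e_def[symmetric] abs_le_iff max_def by (simp split: if_splits)
qed

text \<open>
  The name of the coded real, computed from the input of the iterated limit instead of its value.
\<close>

definition code_input :: "nat \<Rightarrow> baire \<Rightarrow> baire" where
  "code_input k P i = coded_real_name (\<lambda>m. P (set_innermost k i m)) (innermost k i)"

lemma code_input:
  assumes "LimB_iter k P = Some q"
  shows "code_input k P \<in> D_star k" "r_val k (code_input k P) = 1 / 3 + kappa q / 3"
proof -
  have "LimB_iter k (code_input k P) = Some (coded_real_name q)"
    using LimB_iter_lift[OF assms finite_use_coded_real_name] by (simp add: code_input_def[abs_def])
  from D_starI[OF this cauchy_name_coded_real] kappa_range[of q]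
  show "code_input k P \<in> D_star k" "r_val k (code_input k P) = 1 / 3 + kappa q / 3" by auto
qed

text \<open>
  For the input \<open>code_input k P\<close> with all bits 0, the value of the problem is
  \<open>1 / 4 + (1 / 3 + kappa q / 3) / 4 = 1 / 3 + kappa q / 12\<close>, where \<open>q\<close> is the \<open>k\<close>-fold limit of \<open>P\<close>.
  Rescaling and decoding recovers \<open>q\<close>.
\<close>

lemma Lim_le_Xi_hat: "Lim_problem k \<le>\<^sub>W Xi_hat k"
proof (rule weihrauch_leI)
  have "computable (\<lambda>P. Some (code_input k P))"
    unfolding code_input_def coded_real_name_def by (rule computable_total) (intro rec_intros; simp)
  moreover have "computable (\<lambda>p. Some (name_of_table p))"
    by (rule computable_total) (intro rec_intros total_rec_name_of_table; simp)
  ultimately show "computable (\<lambda>P. Some (name_of_table (code_input k P)))"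
    using computable_bind[of "\<lambda>P. Some (code_input k P)" "\<lambda>p. Some (name_of_table p)"] by simp
  have "computable (\<lambda>y. Some (rescale y))"
    unfolding rescale_def by (rule computable_total) (intro rec_intros; simp)
  from computable_bind[OF computable_bind[OF computable_odd_part this] computable_decode_kappa]
  show "computable (\<lambda>w. decode_kappa (rescale (\<lambda>n. w (2 * n + 1))))" by simp
  fix G P u
  assume G: "realizes G (Xi_hat k)" and P: "in_rep (Lim_problem k) P = Some u" "solutions (Lim_problem k) u \<noteq> {}"
  have u: "u = P" using P(1) by (simp add: Lim_problem_def baire_problem_def)
  obtain q where q: "LimB_iter k P = Some q"
    using P(2) by (cases "LimB_iter k P") (auto simp: u Lim_problem_def baire_problem_def)
  obtain y where y: "G (name_of_table (code_input k P)) = Some y"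
    "cauchy_name y (Xi k (code_input k P, \<lambda>_. False))"
    using G code_input(1)[OF q] table_name_of_table unfolding realizes_Xi_hat_iff by blast
  have "Xi k (code_input k P, \<lambda>_. False) = 1 / 3 + kappa q / 12"
    by (simp add: Xi_def t_val_def ell_def code_input(2)[OF q] field_simps)
  with y(2) have "cauchy_name (rescale y) (kappa q)"
    using cauchy_name_rescale[of y "kappa q"] kappa_range(1) by simp
  then have "decode_kappa (rescale y) = Some q" by (rule decode_kappa)
  with y(1) q show "\<exists>t y s z. Some (name_of_table (code_input k P)) = Some t \<and> G t = Some y
    \<and> decode_kappa (rescale (\<lambda>n. join P y (2 * n + 1))) = Some s
    \<and> out_rep (Lim_problem k) s = Some z \<and> z \<in> solutions (Lim_problem k) u"
    by (simp add: u Lim_problem_def baire_problem_def)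
qed

section \<open>Fewer limits do not suffice\<close>

lemma finite_use_computable:
  assumes "computable K" "\<And>x. K (T x) = Some (q x)" "\<And>i. finite_use (\<lambda>x. T x i)"
  shows "finite_use (\<lambda>x. q x n)"
  unfolding finite_use_def
proof
  fix x
  obtain N where N: "\<forall>P r. K P = Some r \<longrightarrow> (\<forall>i<N. P i = T x i) \<longrightarrow> r n = q x n"
    using computable_finite_use[of K "T x" "q x" n, OF assms(1,2)] ..
  have "finite_use (\<lambda>P :: baire. map P [0..<N])" by (rule finite_useI[of N]) simp
  from finite_use_comp[of "\<lambda>P. map P [0..<N]" T, OF this assms(3)]
  have "finite_use (\<lambda>x. map (T x) [0..<N])" .
  then obtain M where M: "\<And>y. \<forall>m<M. y m = x m \<Longrightarrow> map (T y) [0..<N] = map (T x) [0..<N]"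
    unfolding finite_use_def by metis
  have "q y n = q x n" if "\<forall>m<M. y m = x m" for y
    using M[OF that] by (intro N[rule_format, OF assms(2)]) auto
  then show "\<exists>M. \<forall>y. (\<forall>m<M. y m = x m) \<longrightarrow> q y n = q x n" by blast
qed

lemma not_finite_use_ex: "\<not> finite_use (\<lambda>x. \<exists>n. x n)"
proof
  assume "finite_use (\<lambda>x :: nat \<Rightarrow> bool. \<exists>n. x n)"
  from this[unfolded finite_use_def, THEN spec, of "\<lambda>_. False"]
  have "\<exists>N. \<forall>y. (\<forall>m<N. \<not> y m) \<longrightarrow> \<not> (\<exists>n. y (n :: nat))" by simp
  then obtain N :: nat where "\<forall>y. (\<forall>m<N. \<not> y m) \<longrightarrow> \<not> (\<exists>n. y n)" ..
  from this[THEN spec, of "\<lambda>n. N \<le> n"] have "\<not> (\<exists>n. N \<le> n)" by simp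
  then show False by blast
qed

text \<open>
  Infinitely many ones is not a pointwise limit of continuous predicates. Given such predicates
  \<open>g s\<close>, a sequence is built in stages: append a one, and consider the continuation by zeros only.
  It has finitely many ones, so some later \<open>g s\<close> rejects it, and does so because of a finite prefix, to
  which the construction is then committed. The resulting sequence has infinitely many ones and is
  rejected infinitely often.
\<close>

lemma infinitely_often_not_limit:
  assumes fin: "\<And>s. finite_use (g s)"
    and lim: "\<And>x. \<forall>\<^sub>F s in sequentially. g s x \<longleftrightarrow> (\<exists>\<^sub>\<infinity>n. x n)"
  shows False
proof -
  \<comment> \<open>stage \<open>(x, N, s)\<close>: the sequence is committed to \<open>x\<close> below \<open>N\<close>, and \<open>s\<close> is the last index used\<close>
  define step where "step st st' \<longleftrightarrow> (case (st, st') of ((x, N, s), (x', N', s')) \<Rightarrow>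
      N < N' \<and> s < s' \<and> (\<forall>m<N. x' m = x m) \<and> x' N \<and>
      (\<forall>z. (\<forall>m<N'. z m = x' m) \<longrightarrow> \<not> g s' z))"
    for st st' :: "(nat \<Rightarrow> bool) \<times> nat \<times> nat"
  have "\<exists>st'. step st st'" for st
  proof -
    obtain x N s where st: "st = (x, N, s)" by (cases st)
    define x' where "x' m \<longleftrightarrow> m < N \<and> x m \<or> m = N" for m
    have "finite {m. x' m}" by (rule finite_subset[of _ "{..N}"]) (auto simp: x'_def)
    then have few: "\<not> (\<exists>\<^sub>\<infinity>n. x' n)" unfolding INFM_iff_infinite by blast
    from lim[of x'] have "\<forall>\<^sub>F s in sequentially. \<not> g s x'"
      by (rule eventually_mono) (use few in blast)
    then obtain s0 where s0: "\<And>s. s0 \<le> s \<Longrightarrow> \<not> g s x'" unfolding eventually_sequentially by blast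
    define s' where "s' = max s0 (Suc s)"
    have s': "s < s'" "\<not> g s' x'" using s0[of s'] by (auto simp: s'_def)
    obtain M where M: "\<And>z. \<forall>m<M. z m = x' m \<Longrightarrow> g s' z = g s' x'"
      using fin[of s'] unfolding finite_use_def by metis
    have "\<not> g s' z" if "\<forall>m<max M (Suc N). z m = x' m" for z
      using M[of z] that s'(2) by simp
    moreover have "\<forall>m<N. x' m = x m" "x' N" by (auto simp: x'_def)
    ultimately have "step st (x', max M (Suc N), s')"
      using s'(1) by (simp add: step_def st)
    then show ?thesis ..
  qed
  then obtain f where f: "\<And>st. step st (f st)" by metis
  define S where "S i = (f ^^ i) (\<lambda>_. False, 0, 0)" for i
  have S: "step (S i) (S (Suc i))" for i using f by (simp add: S_def)
  define X N T where "X i = fst (S i)" and "N i = fst (snd (S i))" and "T i = snd (snd (S i))" for i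
  have XNT: "N i < N (Suc i)" "T i < T (Suc i)" "\<And>m. m < N i \<Longrightarrow> X (Suc i) m = X i m"
    "X (Suc i) (N i)" "\<And>z. \<forall>m<N (Suc i). z m = X (Suc i) m \<Longrightarrow> \<not> g (T (Suc i)) z" for i
    using S[of i] unfolding step_def X_def N_def T_def by (auto split: prod.splits)
  have "strict_mono N" "strict_mono T" using XNT(1,2) by (simp_all add: strict_mono_Suc_iff)
  then have ge: "i \<le> N i" "i \<le> T i" for i by (simp_all add: strict_mono_imp_increasing)
  define z where "z m = X (Suc m) m" for m
  have const: "X j m = X i m" if "i \<le> j" "m < N i" for i j m
    using that(1)
  proof (induction rule: dec_induct)
    case (step n)
    have "m < N n" using that(2) \<open>i \<le> n\<close> \<open>strict_mono N\<close> by (meson less_le_trans strict_mono_less_eq)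
    with step.IH XNT(3) show ?case by simp
  qed simp
  have z: "z m = X i m" if "m < N i" for i m
  proof -
    have "m < N (Suc m)" using ge(1)[of "Suc m"] by simp
    with that const[of i "Suc m" m] const[of "Suc m" i m] show ?thesis
      unfolding z_def by (cases "i \<le> Suc m") auto
  qed
  have "z (N i)" for i using z[of "N i" "Suc i"] XNT(1,4) by simp
  then have "\<exists>\<^sub>\<infinity>n. z n" unfolding INFM_nat_le using ge(1) by blast
  with lim[of z] have "\<forall>\<^sub>F s in sequentially. g s z" by simp
  then obtain i where "\<And>s. i \<le> s \<Longrightarrow> g s z" unfolding eventually_sequentially by blast
  moreover have "\<not> g (T (Suc i)) z" by (rule XNT(5)) (simp add: z)
  moreover have "i \<le> T (Suc i)" using ge(2)[of "Suc i"] by simp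
  ultimately show False by blast
qed

text \<open>
  A Boolean as a rational endpoint of the interval from 1/3 to 2/3.
\<close>

definition bit_code :: "bool \<Rightarrow> nat" where
  "bit_code v = rat_code (if v then 2 else 1) 3"

lemma Xi_bit:
  assumes "LimB_iter k p = Some (\<lambda>_. bit_code v)"
  shows "p \<in> D_star k" "Xi k (p, \<lambda>_. False) = (if v then 5 / 12 else 1 / 3)"
proof -
  have "cauchy_name (\<lambda>_. bit_code v) (if v then 2 / 3 else 1 / 3)"
    by (simp add: cauchy_name_iff bit_code_def)
  from D_starI[OF assms this] show "p \<in> D_star k" "Xi k (p, \<lambda>_. False) = (if v then 5 / 12 else 1 / 3)"
    by (auto simp: Xi_def t_val_def ell_def)
qed

text \<open>
  The two values 1/3 and 5/12 are separated by 3/8, with a distance of 1/24 on both sides, so an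
  approximation with error 1/32 decides between them.
\<close>

definition reads_large :: "nat \<Rightarrow> bool" where
  "reads_large c \<longleftrightarrow> 3 / 8 < rat_val c"

text \<open>
  If a predicate \<open>\<phi>\<close> is a \<open>k\<close>-fold limit of continuous data, then a solution of the problem with \<open>m\<close>
  limits makes it an \<open>m\<close>-fold limit of continuous data: the truth value of \<open>\<phi> x\<close> is put into \<open>r_val\<close>
  and read off from the entry of the answer with index 5.
\<close>

lemma limits_yield_finite_use:
  assumes K: "computable K" "realizes (LimB_iter m \<circ>\<^sub>m K) (Xi_hat k)"
    and X: "\<And>i. finite_use (\<lambda>x. X x i)" "\<And>x. LimB_iter k (X x) = Some (\<lambda>_. bit_code (\<phi> x))"
  obtains q y where "\<And>n. finite_use (\<lambda>x :: nat \<Rightarrow> bool. q x n)" "\<And>x. LimB_iter m (q x) = Some (y x)"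
    "\<And>x. reads_large (y x 5) \<longleftrightarrow> \<phi> x"
proof -
  define T where "T x = name_of_table (X x)" for x
  have r: "\<exists>r. (LimB_iter m \<circ>\<^sub>m K) (T x) = Some r \<and> cauchy_name r (Xi k (X x, \<lambda>_. False))" for x
    using K(2) Xi_bit(1)[OF X(2)] table_name_of_table unfolding realizes_Xi_hat_iff T_def by blast
  have "\<exists>q y. K (T x) = Some q \<and> LimB_iter m q = Some y \<and> cauchy_name y (Xi k (X x, \<lambda>_. False))" for x
    using r[of x] unfolding map_comp_Some_iff by blast
  then obtain q y where q: "\<And>x. K (T x) = Some (q x)" "\<And>x. LimB_iter m (q x) = Some (y x)"
    "\<And>x. cauchy_name (y x) (Xi k (X x, \<lambda>_. False))"
    by metis
  have "finite_use (\<lambda>x. T x i)" for i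
    unfolding T_def by (rule finite_use_comp[OF finite_use_name_of_table]) (rule X(1))
  from finite_use_computable[OF K(1) q(1) this] have "finite_use (\<lambda>x. q x n)" for n .
  moreover have "reads_large (y x 5) \<longleftrightarrow> \<phi> x" for x
  proof -
    have "\<bar>rat_val (y x 5) - (if \<phi> x then 5 / 12 else 1 / 3)\<bar> \<le> 1 / 32"
      using q(3)[of x] unfolding Xi_bit(2)[OF X(2)] cauchy_name_iff by (auto dest: spec[of _ 5])
    then have "rat_val (y x 5) - (if \<phi> x then 5 / 12 else 1 / 3) \<le> 1 / 32"
      "- (rat_val (y x 5) - (if \<phi> x then 5 / 12 else 1 / 3)) \<le> 1 / 32"
      unfolding abs_le_iff by blast+
    then show ?thesis unfolding reads_large_def by (cases "\<phi> x"; simp only: if_True if_False) argo+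
  qed
  ultimately show ?thesis using that q(2) by blast
qed

lemma finite_use_fun: "finite_use f \<Longrightarrow> finite_use (\<lambda>x. h (f x))"
  unfolding finite_use_def by metis

definition exists_input :: "(nat \<Rightarrow> bool) \<Rightarrow> baire" where
  "exists_input x i = bit_code (\<exists>n\<le>fst (prod_decode i). x n)"

text \<open>
  One limit suffices for the existence of a one.
\<close>

lemma exists_input:
  "finite_use (\<lambda>x. exists_input x i)"
  "LimB_iter 1 (exists_input x) = Some (\<lambda>_. bit_code (\<exists>n. x n))"
proof -
  show "finite_use (\<lambda>x. exists_input x i)"
    by (rule finite_useI[of "Suc (fst (prod_decode i))"]) (auto simp: exists_input_def intro!: arg_cong[of _ _ bit_code])
  have "\<forall>\<^sub>F s in sequentially. (\<exists>n\<le>s. x n) \<longleftrightarrow> (\<exists>n. x n)"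
  proof (cases "\<exists>n. x n")
    case True
    then obtain n where "x n" ..
    then show ?thesis by (intro eventually_mono[OF eventually_ge_at_top[of n]]) auto
  qed simp
  then have "\<forall>\<^sub>F s in sequentially. exists_input x (prod_encode (s, j)) = bit_code (\<exists>n. x n)" for j
    by (rule eventually_mono) (simp add: exists_input_def)
  then show "LimB_iter 1 (exists_input x) = Some (\<lambda>_. bit_code (\<exists>n. x n))"
    by (simp add: LimB_eq_Some_iff)
qed

definition infinitely_often_input :: "(nat \<Rightarrow> bool) \<Rightarrow> baire" where
  "infinitely_often_input x i = bit_code
     (\<exists>n\<le>fst (prod_decode i). fst (prod_decode (snd (prod_decode i))) \<le> n \<and> x n)"

text \<open>
  Two limits suffice for infinitely many ones: the inner one looks for a one at or beyond \<open>a\<close>, and the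
  outer one lets \<open>a\<close> tend to infinity.
\<close>

lemma infinitely_often_input:
  "finite_use (\<lambda>x. infinitely_often_input x i)"
  "LimB_iter 2 (infinitely_often_input x) = Some (\<lambda>_. bit_code (\<exists>\<^sub>\<infinity>n. x n))"
proof -
  show "finite_use (\<lambda>x. infinitely_often_input x i)"
    by (rule finite_useI[of "Suc (fst (prod_decode i))"])
      (auto simp: infinitely_often_input_def intro!: arg_cong[of _ _ bit_code])
  define Q where "Q i = bit_code (\<exists>n\<ge>fst (prod_decode i). x n)" for i
  have inner: "\<forall>\<^sub>F s in sequentially. (\<exists>n\<le>s. a \<le> n \<and> x n) \<longleftrightarrow> (\<exists>n\<ge>a. x n)" for a
  proof (cases "\<exists>n\<ge>a. x n")
    case True
    then obtain n where "n \<ge> a" "x n" by blast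
    then show ?thesis by (intro eventually_mono[OF eventually_ge_at_top[of n]]) auto
  next
    case False
    then show ?thesis by (intro always_eventually) blast
  qed
  have "\<forall>\<^sub>F s in sequentially. infinitely_often_input x (prod_encode (s, j)) = Q j" for j
    by (rule eventually_mono[OF inner[of "fst (prod_decode j)"]]) (simp add: infinitely_often_input_def Q_def)
  then have 1: "LimB (infinitely_often_input x) = Some Q" by (simp add: LimB_eq_Some_iff)
  have "\<forall>\<^sub>F a in sequentially. (\<exists>n\<ge>a. x n) \<longleftrightarrow> (\<exists>\<^sub>\<infinity>n. x n)"
  proof (cases "\<exists>\<^sub>\<infinity>n. x n")
    case True
    then show ?thesis by (simp add: INFM_nat_le)
  next
    case False
    then obtain a where a: "\<And>n. a \<le> n \<Longrightarrow> \<not> x n" by (auto simp: INFM_nat_le)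
    show ?thesis using eventually_ge_at_top[of a]
      by (rule eventually_mono) (use a False in \<open>blast intro: order_trans\<close>)
  qed
  then have "\<forall>\<^sub>F s in sequentially. Q (prod_encode (s, j)) = bit_code (\<exists>\<^sub>\<infinity>n. x n)" for j
    by (rule eventually_mono) (simp add: Q_def)
  then have 2: "LimB Q = Some (\<lambda>_. bit_code (\<exists>\<^sub>\<infinity>n. x n))" by (simp add: LimB_eq_Some_iff)
  show "LimB_iter 2 (infinitely_often_input x) = Some (\<lambda>_. bit_code (\<exists>\<^sub>\<infinity>n. x n))"
    by (simp add: numeral_2_eq_2 map_comp_Some_iff 1 2)
qed

text \<open>
  No limit would make the existence of a one continuous. Fewer than two limits would make
  infinitely many ones a limit of continuous predicates, a constant sequence of predicates being
  used if there is no limit at all.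
\<close>

lemma Xi_hat_needs_limits:
  assumes "k \<le> 2" "computable K" "realizes (LimB_iter m \<circ>\<^sub>m K) (Xi_hat k)"
  shows "k \<le> m"
proof (rule ccontr)
  assume "\<not> k \<le> m"
  with assms(1) consider "k = 1" "m = 0" | "k = 2" "m = 0" | "k = 2" "m = 1" by linarith
  then show False
  proof cases
    case 1
    obtain q y where q: "\<And>n. finite_use (\<lambda>x. q x n)" "\<And>x. LimB_iter 0 (q x) = Some (y x)"
      "\<And>x :: nat \<Rightarrow> bool. reads_large (y x 5) \<longleftrightarrow> (\<exists>n. x n)"
      using limits_yield_finite_use[OF assms(2,3)[unfolded 1] exists_input] by blast
    have "finite_use (\<lambda>x. reads_large (q x 5))" by (rule finite_use_fun[OF q(1)])
    with q(2,3) not_finite_use_ex show False by simp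
  next
    case 2
    obtain q y where q: "\<And>n. finite_use (\<lambda>x. q x n)" "\<And>x. LimB_iter 0 (q x) = Some (y x)"
      "\<And>x :: nat \<Rightarrow> bool. reads_large (y x 5) \<longleftrightarrow> (\<exists>\<^sub>\<infinity>n. x n)"
      using limits_yield_finite_use[OF assms(2,3)[unfolded 2] infinitely_often_input] by blast
    show False
    proof (rule infinitely_often_not_limit[of "\<lambda>_ x. reads_large (q x 5)"])
      fix x
      have "reads_large (q x 5) \<longleftrightarrow> (\<exists>\<^sub>\<infinity>n. x n)" using q(2)[of x] q(3)[of x] by simp
      then show "\<forall>\<^sub>F s in sequentially. reads_large (q x 5) \<longleftrightarrow> (\<exists>\<^sub>\<infinity>n. x n)" by (intro always_eventually allI)
    qed (rule finite_use_fun[OF q(1)])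
  next
    case 3
    obtain q y where q: "\<And>n. finite_use (\<lambda>x. q x n)" "\<And>x. LimB_iter 1 (q x) = Some (y x)"
      "\<And>x :: nat \<Rightarrow> bool. reads_large (y x 5) \<longleftrightarrow> (\<exists>\<^sub>\<infinity>n. x n)"
      using limits_yield_finite_use[OF assms(2,3)[unfolded 3] infinitely_often_input] by blast
    show False
    proof (rule infinitely_often_not_limit[of "\<lambda>s x. reads_large (q x (prod_encode (s, 5)))"])
      fix x
      have "LimB (q x) = Some (y x)" using q(2)[of x] by simp
      then have "\<forall>\<^sub>F s in sequentially. q x (prod_encode (s, 5)) = y x 5"
        unfolding LimB_eq_Some_iff by blast
      then show "\<forall>\<^sub>F s in sequentially. reads_large (q x (prod_encode (s, 5))) \<longleftrightarrow> (\<exists>\<^sub>\<infinity>n. x n)"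
        by (rule eventually_mono) (simp add: q(3))
    qed (rule finite_use_fun[OF q(1)])
  qed
qed

lemma SCI_lim_Comp_Xi_hat:
  assumes "k \<le> 2"
  shows "SCI_lim_Comp (Xi_hat k) = enat k"
  unfolding SCI_lim_Comp_def
proof (rule antisym)
  show "Inf {enat m | m. \<exists>K. computable K \<and> realizes (LimB_iter m \<circ>\<^sub>m K) (Xi_hat k)} \<le> enat k"
    using Xi_hat_by_limits by (intro Inf_lower) blast
  show "enat k \<le> Inf {enat m | m. \<exists>K. computable K \<and> realizes (LimB_iter m \<circ>\<^sub>m K) (Xi_hat k)}"
    using Xi_hat_needs_limits[OF assms] by (intro Inf_greatest) auto
qed

section \<open>The raw solvability complexity index\<close>

lemma constant_in_D_star: "(\<lambda>_. rat_code 1 2) \<in> D_star k"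
proof -
  have "LimB_iter k (\<lambda>_. c) = Some (\<lambda>_. c)" for c
    by (induction k) (simp_all add: map_comp_Some_iff LimB_eq_Some_iff)
  moreover have "cauchy_name (\<lambda>_. rat_code 1 2) (1 / 2)" by (simp add: cauchy_name_iff)
  ultimately show ?thesis by (rule D_starI) simp
qed

lemma P_star_simps [simp]:
  "target (P_star k) = Xi k" "inputs (P_star k) = D_star k \<times> UNIV"
  "space_of (P_star k) = {0..1}" "metric_of (P_star k) = dist"
  "evals (P_star k) = insert eval_star (range eval_bit)"
  by (simp_all add: P_star_def Omega_star_def)

lemma eval_simps [simp]:
  "eval_star (p, b) = eval_star (p', b') \<longleftrightarrow> p = p'"
  "eval_bit n (p, b) = eval_bit n (p', b') \<longleftrightarrow> b n = b' n"
  by (auto simp: eval_star_def eval_bit_def kappa_inject of_bool_eq_iff)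

lemma Metric_space_dist: "Metric_space S dist"
  by unfold_locales (auto simp: dist_commute dist_triangle)

lemma sci_problem_P_star: "sci_problem (P_star k)"
  unfolding sci_problem_def
proof (intro conjI ballI impI)
  show "Metric_space (space_of (P_star k)) (metric_of (P_star k))"
    by (simp add: Metric_space_dist)
  show "target (P_star k) \<in> inputs (P_star k) \<rightarrow> space_of (P_star k)"
    using Xi_range by fastforce
next
  fix x y assume "\<forall>l\<in>evals (P_star k). l x = l y"
  then have "x = y" by (cases x; cases y) (auto simp: fun_eq_iff)
  then show "target (P_star k) x = target (P_star k) y" by simp
qed simp

text \<open>
  Finitely many evaluations omit some bit of \<open>b\<close>, and every bit influences the value.
\<close>

lemma no_raw_tower_0: "\<not> raw_tower (P_star k) 0 \<Gamma>"
proof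
  assume T: "raw_tower (P_star k) 0 \<Gamma>"
  define p :: baire where "p = (\<lambda>_. rat_code 1 2)"
  have p: "p \<in> D_star k" unfolding p_def by (rule constant_in_D_star)
  define x where "x = (p, \<lambda>_::nat. False)"
  obtain Q where Q: "general_algorithm (P_star k) (\<Gamma> []) Q" and \<Gamma>: "\<And>y. y \<in> inputs (P_star k) \<Longrightarrow> \<Gamma> [] y = Xi k y"
    using T unfolding raw_tower_def by auto
  have x: "x \<in> inputs (P_star k)" using p by (simp add: x_def)
  have *: "finite (Q x) \<and> Q x \<subseteq> evals (P_star k) \<and>
      (\<forall>y\<in>inputs (P_star k). (\<forall>l\<in>Q x. l y = l x) \<longrightarrow> \<Gamma> [] y = \<Gamma> [] x)"
    using Q x unfolding general_algorithm_def by blast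
  have fin: "finite (Q x)" "Q x \<subseteq> insert eval_star (range eval_bit)"
    using * by simp_all
  have agree: "\<Gamma> [] y = \<Gamma> [] x" if "y \<in> inputs (P_star k)" "\<forall>l\<in>Q x. l y = l x" for y
    using * that by blast
  have "inj eval_bit"
  proof (rule injI, rule ccontr)
    fix m n assume "eval_bit m = eval_bit n" "m \<noteq> n"
    then have "eval_bit m (p, \<lambda>i. i = m) = eval_bit n (p, \<lambda>i. i = m)" by simp
    then have "of_bool (m = m) = (of_bool (n = m) :: complex)" by (simp only: eval_bit_def prod.case)
    with \<open>m \<noteq> n\<close> show False by simp
  qed
  then have "infinite (range eval_bit)" by (simp add: finite_image_iff)
  with fin(1) obtain n where n: "eval_bit n \<notin> Q x" by (meson finite_subset image_subset_iff rangeI)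
  \<comment> \<open>flip a bit that is not evaluated at \<open>x\<close>\<close>
  define y where "y = (p, \<lambda>i. i = n)"
  have "\<forall>l\<in>Q x. l y = l x"
  proof
    fix l assume l: "l \<in> Q x"
    with fin(2) consider "l = eval_star" | m where "l = eval_bit m" by blast
    then show "l y = l x"
      using l n by cases (auto simp: x_def y_def)
  qed
  moreover have y: "y \<in> inputs (P_star k)" using p by (simp add: y_def)
  ultimately have "Xi k y = Xi k x" using agree \<Gamma> x by metis
  then have "tau (\<lambda>i. i = n) = tau (\<lambda>_. False)" by (simp add: x_def y_def Xi_def t_val_def)
  then show False unfolding tau_inject by (auto simp: fun_eq_iff)
qed

definition truncated_Xi :: "nat \<Rightarrow> nat \<Rightarrow> baire \<times> (nat \<Rightarrow> bool) \<Rightarrow> real" where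
  "truncated_Xi k n = (\<lambda>(p, b). 1 / 4 + tau_num b n / 3 ^ n / 8 + ell * r_val k p)"

lemma truncated_Xi_range:
  assumes "p \<in> D_star k"
  shows "truncated_Xi k n (p, b) \<in> {0..1}"
proof -
  define t where "t = real (tau_num b n) / 3 ^ n"
  have "t \<le> tau b" using tau_bounds(1)[of b n] by (simp only: t_def)
  then have "t \<le> 1" using tau_range(2)[of b] by (rule order_trans)
  moreover have "0 \<le> t" by (simp add: t_def)
  moreover have "1 / 3 \<le> r_val k p" "r_val k p \<le> 2 / 3" using assms by (auto simp: D_star_def)
  ultimately have "0 \<le> 1 / 4 + t / 8 + 1 / 4 * r_val k p" "1 / 4 + t / 8 + 1 / 4 * r_val k p \<le> 1"
    by argo+
  then show ?thesis unfolding truncated_Xi_def ell_def t_def by simp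
qed

text \<open>
  A general algorithm is not required to be computable: the single evaluation \<open>kappa p\<close> determines
  \<open>p\<close> and thereby \<open>r_val k p\<close>, whatever the number of limits behind it. Only the infinitely many bits
  of \<open>b\<close> call for a limit, along finite prefixes.
\<close>

lemma raw_tower_1: "raw_tower (P_star k) 1 (\<lambda>ns. truncated_Xi k (hd ns))"
  unfolding raw_tower_def
proof (intro conjI allI impI ballI)
  fix ns :: "nat list"
  define n where "n = hd ns"
  define Q where "Q = (\<lambda>x :: baire \<times> (nat \<Rightarrow> bool). insert eval_star (eval_bit ` {..<n}))"
  have "general_algorithm (P_star k) (truncated_Xi k n) Q"
    unfolding general_algorithm_def
  proof (intro ballI conjI impI)
    fix x assume "x \<in> inputs (P_star k)"
    then obtain p b where x: "x = (p, b)" and p: "p \<in> D_star k" by auto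
    show "truncated_Xi k n x \<in> space_of (P_star k)"
      using truncated_Xi_range[OF p] by (simp add: x)
    fix y assume y: "y \<in> inputs (P_star k)" "\<forall>l\<in>Q x. l y = l x"
    obtain p' b' where y': "y = (p', b')" by (cases y)
    with y(2) have "p' = p" "\<And>m. m < n \<Longrightarrow> b' m = b m" by (auto simp: Q_def x)
    moreover from this(2) have "tau_num b' n = tau_num b n" by (induction n) auto
    ultimately show "truncated_Xi k n y = truncated_Xi k n x" by (simp add: x y' truncated_Xi_def)
  qed (auto simp: Q_def)
  then show "\<exists>Q. general_algorithm (P_star k) (truncated_Xi k (hd ns)) Q" unfolding n_def by blast
next
  fix x assume "x \<in> inputs (P_star k)"
  then obtain p b where x: "x = (p, b)" and p: "p \<in> D_star k" by auto
  interpret Metric_space "{0..1::real}" dist by (rule Metric_space_dist)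
  have "(\<lambda>n. tau_num b n / 3 ^ n) \<longlonglongrightarrow> tau b"
  proof (rule LIMSEQ_I)
    fix e :: real assume "0 < e"
    then obtain N where N: "(1 / 3) ^ N < e" using real_arch_pow_inv[of e "1/3"] by auto
    have "norm (tau_num b n / 3 ^ n - tau b) < e" if "n \<ge> N" for n
    proof -
      have "(1 / 3 :: real) ^ n \<le> (1 / 3) ^ N" using that by (intro power_decreasing) auto
      then show ?thesis using tau_approx[of b n] N by (simp add: power_one_over)
    qed
    then show "\<exists>N. \<forall>n\<ge>N. norm (tau_num b n / 3 ^ n - tau b) < e" by blast
  qed
  moreover have "(\<lambda>n. 1 / 4 + f n / 8 + c) \<longlonglongrightarrow> 1 / 4 + l / 8 + c" if "f \<longlonglongrightarrow> l"
    for f :: "nat \<Rightarrow> real" and l c using that by (auto intro!: tendsto_intros)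
  ultimately have "(\<lambda>n. truncated_Xi k n x) \<longlonglongrightarrow> 1 / 4 + tau b / 8 + ell * r_val k p"
    unfolding truncated_Xi_def x prod.case by blast
  then have "(\<lambda>n. truncated_Xi k n x) \<longlonglongrightarrow> Xi k x"
    by (simp add: x Xi_def t_val_def)
  moreover have "truncated_Xi k n x \<in> {0..1}" for n
    unfolding x by (rule truncated_Xi_range[OF p])
  ultimately have "limitin mtopology (\<lambda>n. truncated_Xi k n x) (Xi k x) sequentially"
    using Xi_range[OF p, of b] unfolding limit_metric_sequentially LIMSEQ_iff dist_real_def x by simp
  then show "iterated_limit (space_of (P_star k)) (metric_of (P_star k)) 1
      (\<lambda>ns. truncated_Xi k (hd ns) x) (target (P_star k) x)"
    by auto
qed

lemma SCI_G_P_star: "SCI_G (P_star k) = 1"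
  unfolding SCI_G_def
proof (rule antisym)
  show "Inf {enat m |m. \<exists>\<Gamma>. raw_tower (P_star k) m \<Gamma>} \<le> 1"
    using raw_tower_1[of k] by (intro Inf_lower) (auto simp: one_enat_def)
  show "1 \<le> Inf {enat m |m. \<exists>\<Gamma>. raw_tower (P_star k) m \<Gamma>}"
  proof (rule Inf_greatest)
    fix i assume "i \<in> {enat m |m. \<exists>\<Gamma>. raw_tower (P_star k) m \<Gamma>}"
    then obtain m \<Gamma> where "i = enat m" "raw_tower (P_star k) m \<Gamma>" by blast
    with no_raw_tower_0 show "1 \<le> i" by (cases m) (auto simp: one_enat_def)
  qed
qed

section \<open>Degrees\<close>

lemma Xi_hat_equiv_Lim: "Xi_hat k \<equiv>\<^sub>W Lim_problem k"
  unfolding weihrauch_equiv_def using Xi_hat_le_Lim Lim_le_Xi_hat by blast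

text \<open>
  For \<open>k = 0\<close>, the solution with \<open>k\<close> limits is a computable realizer, and the constant name of 1/2
  gives a computable instance.
\<close>

lemma weihrauch_degree_Xi_hat_0: "weihrauch_degree (Xi_hat 0) = degree_one"
proof (rule weihrauch_degree_eq_one)
  obtain K where "computable K" "realizes (LimB_iter 0 \<circ>\<^sub>m K) (Xi_hat 0)"
    using Xi_hat_by_limits by blast
  moreover have "LimB_iter 0 \<circ>\<^sub>m K = K" by (simp add: map_comp_def fun_eq_iff split: option.split)
  ultimately show "computable_problem (Xi_hat 0)"
    unfolding computable_problem_def by auto
  define p :: baire where "p = (\<lambda>_. rat_code 1 2)"
  have p: "p \<in> D_star 0" unfolding p_def by (rule constant_in_D_star)
  have "computable (\<lambda>_. Some (name_of_table p))"
    unfolding p_def by (rule computable_total) (intro total_rec_name_of_table rec_intros; simp)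
  then have "computable_point (name_of_table p)" by (simp add: computable_point_def)
  moreover have "in_rep (Xi_hat 0) (name_of_table p) = Some (table (p, \<lambda>_. False))"
    unfolding in_rep_Xi_hat using p table_name_of_table by blast
  ultimately show "has_computable_instance (Xi_hat 0)"
    unfolding has_computable_instance_def using solutions_Xi_hat[OF p] by (metis insert_not_empty)
qed

theorem theorem10p1:
  shows "(\<forall>k\<in>{0, 1, 2::nat}.
            sci_problem (P_star k) \<and>
            SCI_G (P_star k) = 1 \<and>
            Xi_hat k \<equiv>\<^sub>W Lim_problem k \<and>
            SCI_lim_Comp (Xi_hat k) = enat k)
       \<and> weihrauch_degree (Xi_hat 0) = degree_one
       \<and> weihrauch_degree (Xi_hat 1) = weihrauch_degree (Lim_problem 1)
       \<and> weihrauch_degree (Xi_hat 2) = weihrauch_degree (Lim_problem 2)"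
  by (intro conjI ballI sci_problem_P_star SCI_G_P_star Xi_hat_equiv_Lim weihrauch_degree_Xi_hat_0
      weihrauch_degree_eq[OF Xi_hat_equiv_Lim] SCI_lim_Comp_Xi_hat) auto

end
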